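(* Suppose there exist constants $q>0$ and $C>0$ such that for all $d,L\ge 1$, all norms $\|\cdot\|_1,\dots,\|\cdot\|_L$ on $\mathbb{R}^d$ and all i.i.d. mean zero Gaussian random vectors $G,G_1,\dots,G_L$ in $\mathbb{R}^d$, the random variables $Y=\max_{l\le L}\|G\|_l$ and $X=\max_{l\le L}\|G_l\|_l$ satisfy $$\|m_n(Y)\|_q\le C\,\|m_n(X)\|_q\qquad\text{for all } n\ge 1 .$$ Then there exists an absolute constant $\alpha$ such that $$\mu\Bigl(\alpha\Bigl(\bigcap_{i=1}^l A_i\Bigr)\Bigr)\ge\prod_{i=1}^l\mu(A_i)$$ for every $d\ge1$, every centered Gaussian measure $\mu$ on $\mathbb{R}^d$, every $l\ge 1$ and all convex, symmetric (Borel) sets $A_1,\dots,A_l\subseteq\mathbb{R}^d$.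
   Context: $\|W\|_q=(E|W|^q)^{1/q}$ for real random variables $W$. For a nonnegative random variable $W$, $m_n(W)$ denotes the minimum of $n$ i.i.d. copies of $W$. A set $A$ is symmetric if $A=-A$. *)

theory Defs
  imports "HOL-Probability.Probability"
begin

text \<open>The dimension is quantified inside the hypothesis and inside the conclusion, so it cannot be
  a type. Points of the Euclidean space of dimension \<open>d\<close> are the functions in
  \<open>{..<d} \<rightarrow>\<^sub>E UNIV\<close> (value \<open>undefined\<close> off \<open>{..<d}\<close>), i.e. the space of the finite product
  of \<open>d\<close> copies of the real Borel sigma-algebra, which is the Borel sigma-algebra of that space.\<close>

abbreviation borel_R :: "nat \<Rightarrow> (nat \<Rightarrow> real) measure" where
  "borel_R d \<equiv> Pi\<^sub>M {..<d} (\<lambda>_. borel)"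

abbreviation R_space :: "nat \<Rightarrow> (nat \<Rightarrow> real) set" where
  "R_space d \<equiv> {..<d} \<rightarrow>\<^sub>E UNIV"

definition vzero :: "nat \<Rightarrow> nat \<Rightarrow> real" where
  "vzero d = (\<lambda>i\<in>{..<d}. 0)"

definition vadd :: "nat \<Rightarrow> (nat \<Rightarrow> real) \<Rightarrow> (nat \<Rightarrow> real) \<Rightarrow> nat \<Rightarrow> real" where
  "vadd d x y = (\<lambda>i\<in>{..<d}. x i + y i)"

definition vscale :: "nat \<Rightarrow> real \<Rightarrow> (nat \<Rightarrow> real) \<Rightarrow> nat \<Rightarrow> real" where
  "vscale d c x = (\<lambda>i\<in>{..<d}. c * x i)"

definition dilate :: "nat \<Rightarrow> real \<Rightarrow> (nat \<Rightarrow> real) set \<Rightarrow> (nat \<Rightarrow> real) set" where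
  "dilate d c A = vscale d c ` A"

definition symmetric_R :: "nat \<Rightarrow> (nat \<Rightarrow> real) set \<Rightarrow> bool" where
  "symmetric_R d A \<longleftrightarrow> A \<subseteq> R_space d \<and> A = dilate d (- 1) A"

definition convex_R :: "nat \<Rightarrow> (nat \<Rightarrow> real) set \<Rightarrow> bool" where
  "convex_R d A \<longleftrightarrow> A \<subseteq> R_space d \<and>
     (\<forall>x\<in>A. \<forall>y\<in>A. \<forall>u\<ge>0. \<forall>v\<ge>0. u + v = 1 \<longrightarrow> vadd d (vscale d u x) (vscale d v y) \<in> A)"

definition norm_on_R :: "nat \<Rightarrow> ((nat \<Rightarrow> real) \<Rightarrow> real) \<Rightarrow> bool" where
  "norm_on_R d N \<longleftrightarrow>
     (\<forall>x\<in>R_space d. 0 \<le> N x \<and> (N x = 0 \<longleftrightarrow> x = vzero d)) \<and>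
     (\<forall>x\<in>R_space d. \<forall>c. N (vscale d c x) = \<bar>c\<bar> * N x) \<and>
     (\<forall>x\<in>R_space d. \<forall>y\<in>R_space d. N (vadd d x y) \<le> N x + N y)"

text \<open>The law N(0, \<open>\<sigma>\<close>^2); for \<open>\<sigma> = 0\<close> it is the point mass at 0, so that degenerate Gaussian
  measures are included below.\<close>

definition centered_normal :: "real \<Rightarrow> real measure" where
  "centered_normal \<sigma> =
     (if \<sigma> = 0 then return borel 0 else density lborel (\<lambda>x. ennreal (normal_density 0 \<sigma> x)))"

definition centered_gaussian :: "nat \<Rightarrow> (nat \<Rightarrow> real) measure \<Rightarrow> bool" where
  "centered_gaussian d \<mu> \<longleftrightarrow> prob_space \<mu> \<and> sets \<mu> = sets (borel_R d) \<and>
     (\<forall>t. \<exists>\<sigma>\<ge>0. distr \<mu> borel (\<lambda>x. \<Sum>i<d. t i * x i) = centered_normal \<sigma>)"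

definition iid_centered_gaussian ::
  "nat \<Rightarrow> 'w measure \<Rightarrow> ('i \<Rightarrow> 'w \<Rightarrow> nat \<Rightarrow> real) \<Rightarrow> 'i set \<Rightarrow> bool" where
  "iid_centered_gaussian d M G I \<longleftrightarrow> prob_space M \<and>
     prob_space.indep_vars M (\<lambda>_. borel_R d) G I \<and>
     (\<exists>\<mu>. centered_gaussian d \<mu> \<and> (\<forall>i\<in>I. distr M (borel_R d) (G i) = \<mu>))"

text \<open>The Bochner integral is 0 for a non-integrable integrand; below, \<open>Lq_norm\<close> is applied only to
  minima of maxima of norms of Gaussian vectors, which have finite moments of every order.\<close>

definition Lq_norm :: "'w measure \<Rightarrow> real \<Rightarrow> ('w \<Rightarrow> real) \<Rightarrow> real" where
  "Lq_norm M q W = (\<integral>\<omega>. \<bar>W \<omega>\<bar> powr q \<partial>M) powr (1 / q)"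

text \<open>The \<open>n\<close> i.i.d. copies of a random variable \<open>W\<close> on \<open>M\<close> are realised on the \<open>n\<close>-fold product of
  \<open>M\<close>, as \<open>\<omega> \<mapsto> W (\<omega> i)\<close> for \<open>i < n\<close>.\<close>

definition min_copies :: "nat \<Rightarrow> ('w \<Rightarrow> real) \<Rightarrow> (nat \<Rightarrow> 'w) \<Rightarrow> real" where
  "min_copies n W \<omega> = (MIN i\<in>{..<n}. W (\<omega> i))"

definition min_norm :: "'w measure \<Rightarrow> real \<Rightarrow> nat \<Rightarrow> ('w \<Rightarrow> real) \<Rightarrow> real" where
  "min_norm M q n W = Lq_norm (Pi\<^sub>M {..<n} (\<lambda>_. M)) q (min_copies n W)"

text \<open>HOL cannot quantify over types inside a formula, so a statement about all probability spaces
  has to fix the type of sample points. The assertions made here depend only on the joint law of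
  finitely many random vectors, and every such law is realised by the coordinate maps of a
  probability measure on this type.\<close>

type_synonym sample = "nat \<Rightarrow> nat \<Rightarrow> real"

end

theory Submission
  imports Defs "HOL-Library.Function_Algebras"
begin

text \<open>The constant is \<open>C + 2\<close>, and the proof is a tensor power argument.

  Suppose first that the sets are the unit balls of norms \<open>N\<^sub>1, \<dots>, N\<^sub>L\<close>. Let \<open>\<alpha> > C\<close>,
  \<open>a = \<mu>(\<forall>l. N\<^sub>l \<le> \<alpha>) = P(Y \<le> \<alpha>)\<close> and \<open>b = \<Prod>\<^sub>l \<mu>(N\<^sub>l \<le> 1) = P(X \<le> 1)\<close>, and suppose that \<open>a < b\<close>.
  Glue \<open>k\<close> independent copies of the Gaussian vector into one vector in dimension \<open>k d\<close>, and replace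
  each norm by its maximum over the \<open>k\<close> blocks. The two probabilities become \<open>a\<^sup>k\<close> and \<open>b\<^sup>k\<close>, so their
  ratio is exponentially small, while the \<open>q\<close>-th moment of \<open>X\<close> becomes at most \<open>k B\<close>, where \<open>B\<close> is the
  sum of the \<open>q\<close>-th moments of the norms. For the modified variables,
  \<^item> \<open>E m\<^sub>n(Y)\<^sup>q \<ge> \<alpha>\<^sup>q (1 - a\<^sup>k)\<^sup>n\<close>, because the minimum exceeds \<open>\<alpha>\<close> when all copies do, and
  \<^item> \<open>E m\<^sub>n(X)\<^sup>q \<le> 1 + (1 - b\<^sup>k)\<^bsup>n-1\<^esup> k B\<close>, because on the event that the minimum exceeds 1 it is at
    most the first copy and all the other copies exceed 1.

  If \<open>n\<close> is about \<open>k b\<^sup>-\<^sup>k\<close>, the first bound tends to \<open>\<alpha>\<^sup>q\<close> and the second one to 1 as \<open>k\<close> grows. The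
  assumed comparison of minima then gives \<open>\<alpha> \<le> C\<close>, a contradiction
  (\<open>tensor_power_contradiction\<close>, \<open>min_comparison_imp_gaussian_comparison\<close>).

  A general convex symmetric set \<open>A\<close> is reduced to a bounded one, since its measure is the limit
  of the measures of its truncations to cubes. It may still lie in a proper subspace. On its span
  the Minkowski functional of \<open>A\<close> is a norm, which extends to the whole space along a linear complement
  (\<open>exists_norm\<close>). If \<open>\<mu>(A) > 0\<close>, the span has full measure: a linear functional vanishing on \<open>A\<close>
  has a centered normal law with an atom at 0, so it vanishes almost surely
  (\<open>centered_gaussian_zero_one\<close>). Hence a ball of the extended norm is, up to a null set, contained in
  the dilate of \<open>A\<close> by any factor larger than its radius.\<close>

section \<open>Norms and dilations in coordinates\<close>

lemma space_borel_R: "space (borel_R d) = R_space d"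
  by (simp add: space_PiM)

lemma vzero_in_R_space: "vzero d \<in> R_space d"
  by (auto simp: vzero_def)

lemma vadd_in_R_space: "vadd d x y \<in> R_space d"
  by (auto simp: vadd_def)

lemma vscale_in_R_space: "vscale d c x \<in> R_space d"
  by (auto simp: vscale_def)

lemma R_space_eqI:
  "x \<in> R_space d \<Longrightarrow> y \<in> R_space d \<Longrightarrow> (\<And>i. i < d \<Longrightarrow> x i = y i) \<Longrightarrow> x = y"
  by (rule PiE_ext) auto

lemma vscale_vscale: "vscale d a (vscale d b x) = vscale d (a * b) x"
  by (auto simp: vscale_def fun_eq_iff)

lemma vscale_one: "x \<in> R_space d \<Longrightarrow> vscale d 1 x = x"
  by (rule R_space_eqI[OF vscale_in_R_space]) (auto simp: vscale_def)

lemma mem_dilate_iff: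
  assumes "s \<noteq> 0" "A \<subseteq> R_space d"
  shows "x \<in> dilate d s A \<longleftrightarrow> x \<in> R_space d \<and> vscale d (1 / s) x \<in> A"
proof
  assume "x \<in> dilate d s A"
  then obtain a where a: "a \<in> A" "x = vscale d s a"
    by (auto simp: dilate_def)
  then have "vscale d (1 / s) x = a"
    using assms by (simp add: vscale_vscale vscale_one subset_iff)
  with a show "x \<in> R_space d \<and> vscale d (1 / s) x \<in> A"
    by (simp add: vscale_in_R_space)
next
  assume x: "x \<in> R_space d \<and> vscale d (1 / s) x \<in> A"
  then have "x = vscale d s (vscale d (1 / s) x)"
    using assms by (simp add: vscale_vscale vscale_one)
  with x show "x \<in> dilate d s A"
    unfolding dilate_def by blast
qed

lemma convex_R_combine:
  assumes "convex_R d A" "x \<in> A" "y \<in> A" "0 \<le> u" "0 \<le> v" "u + v = 1"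
  shows "(\<lambda>i\<in>{..<d}. u * x i + v * y i) \<in> A"
proof -
  have "vadd d (vscale d u x) (vscale d v y) \<in> A"
    using assms by (auto simp: convex_R_def)
  also have "vadd d (vscale d u x) (vscale d v y) = (\<lambda>i\<in>{..<d}. u * x i + v * y i)"
    by (auto simp: vadd_def vscale_def fun_eq_iff)
  finally show ?thesis .
qed

lemma symmetric_R_minus:
  assumes "symmetric_R d A" "x \<in> A"
  shows "vscale d (- 1) x \<in> A"
  using assms by (auto simp: symmetric_R_def dilate_def)

lemma vzero_mem_convex_symmetric:
  assumes "convex_R d A" "symmetric_R d A" "x \<in> A"
  shows "vzero d \<in> A"
proof -
  have "(\<lambda>i\<in>{..<d}. (1/2) * x i + (1/2) * vscale d (- 1) x i) \<in> A"
    by (rule convex_R_combine[OF assms(1,3) symmetric_R_minus[OF assms(2,3)]]) auto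
  also have "(\<lambda>i\<in>{..<d}. (1/2) * x i + (1/2) * vscale d (- 1) x i) = vzero d"
    by (auto simp: vzero_def vscale_def fun_eq_iff)
  finally show ?thesis .
qed

lemma convex_symmetric_shrink:
  assumes "convex_R d A" "symmetric_R d A" "x \<in> A" "\<bar>c\<bar> \<le> 1"
  shows "vscale d c x \<in> A"
proof -
  have "(\<lambda>i\<in>{..<d}. ((1 + c) / 2) * x i + ((1 - c) / 2) * vscale d (- 1) x i) \<in> A"
    using assms(4)
    by (intro convex_R_combine[OF assms(1,3) symmetric_R_minus[OF assms(2,3)]])
       (auto simp: field_simps)
  also have "(\<lambda>i\<in>{..<d}. ((1 + c) / 2) * x i + ((1 - c) / 2) * vscale d (- 1) x i) = vscale d c x"
    by (auto simp: vscale_def fun_eq_iff field_simps)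
  finally show ?thesis .
qed

lemma measurable_coord [measurable]: "i < d \<Longrightarrow> (\<lambda>x. x i) \<in> borel_measurable (borel_R d)"
  by (rule measurable_component_singleton) simp

lemma vscale_measurable [measurable]: "vscale d c \<in> measurable (borel_R d) (borel_R d)"
  unfolding vscale_def by (intro measurable_restrict) auto

lemma dilate_in_sets:
  assumes "s \<noteq> 0" "A \<in> sets (borel_R d)"
  shows "dilate d s A \<in> sets (borel_R d)"
proof -
  have "A \<subseteq> R_space d"
    using sets.sets_into_space[OF assms(2)] by (simp add: space_borel_R)
  then have "dilate d s A = vscale d (1 / s) -` A \<inter> space (borel_R d)"
    using assms(1) by (auto simp: mem_dilate_iff space_borel_R)
  then show ?thesis
    using assms(2) by (simp add: measurable_sets[OF vscale_measurable])
qed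

lemma norm_on_R_vzero: "norm_on_R d N \<Longrightarrow> N (vzero d) = 0"
  by (simp add: norm_on_R_def vzero_in_R_space)

lemma norm_on_R_nonneg: "norm_on_R d N \<Longrightarrow> x \<in> R_space d \<Longrightarrow> 0 \<le> N x"
  by (simp add: norm_on_R_def)

lemma norm_on_R_vscale: "norm_on_R d N \<Longrightarrow> x \<in> R_space d \<Longrightarrow> N (vscale d c x) = \<bar>c\<bar> * N x"
  by (simp add: norm_on_R_def)

lemma norm_on_R_vadd:
  "norm_on_R d N \<Longrightarrow> x \<in> R_space d \<Longrightarrow> y \<in> R_space d \<Longrightarrow> N (vadd d x y) \<le> N x + N y"
  by (simp add: norm_on_R_def)

lemma norm_on_R_le_coords:
  assumes N: "norm_on_R d N" and x: "x \<in> R_space d"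
  shows "N x \<le> (\<Sum>i<d. \<bar>x i\<bar> * N (\<lambda>j\<in>{..<d}. if j = i then 1 else 0))"
proof -
  define e where "e i = (\<lambda>j\<in>{..<d}. if j = i then 1 else (0::real))" for i
  define cut where "cut m = (\<lambda>i\<in>{..<d}. if i < m then x i else 0)" for m
  have eR: "e i \<in> R_space d" for i
    by (auto simp: e_def)
  have cutR: "cut m \<in> R_space d" for m
    by (auto simp: cut_def)
  have "N (cut m) \<le> (\<Sum>i<m. \<bar>x i\<bar> * N (e i))" if "m \<le> d" for m
    using that
  proof (induction m)
    case 0
    have "cut 0 = vzero d"
      by (auto simp: cut_def vzero_def)
    then show ?case
      using norm_on_R_vzero[OF N] by simp
  next
    case (Suc m)
    have "cut (Suc m) = vadd d (cut m) (vscale d (x m) (e m))"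
      by (auto simp: cut_def vadd_def vscale_def e_def fun_eq_iff less_Suc_eq)
    then have "N (cut (Suc m)) \<le> N (cut m) + \<bar>x m\<bar> * N (e m)"
      using norm_on_R_vadd[OF N cutR[of m] vscale_in_R_space[of d "x m" "e m"]]
      by (simp add: norm_on_R_vscale[OF N eR])
    then show ?case
      using Suc by simp
  qed
  from this[of d] have "N (cut d) \<le> (\<Sum>i<d. \<bar>x i\<bar> * N (e i))"
    by simp
  moreover have "cut d = x"
    by (rule R_space_eqI[OF _ x]) (auto simp: cut_def)
  ultimately show ?thesis
    by (simp add: e_def)
qed

text \<open>A norm is Lipschitz in the coordinates, hence (composed with restriction to \<open>{..<d}\<close>) continuous for
  the product topology on all of \<open>nat \<Rightarrow> real\<close>, whose Borel sigma-algebra is the product one.\<close>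

lemma norm_on_R_measurable:
  assumes N: "norm_on_R d N"
  shows "N \<in> borel_measurable (borel_R d)"
proof -
  define c where "c i = N (\<lambda>j\<in>{..<d}. if j = i then 1 else 0)" for i
  define N' where "N' y = N (restrict y {..<d})" for y :: "nat \<Rightarrow> real"
  have tri: "N' y \<le> N' z + (\<Sum>i<d. \<bar>y i - z i\<bar> * c i)" for y z
  proof -
    define w where "w = (\<lambda>i\<in>{..<d}. y i - z i)"
    have w: "w \<in> R_space d" and z: "restrict z {..<d} \<in> R_space d"
      by (auto simp: w_def)
    have "restrict y {..<d} = vadd d (restrict z {..<d}) w"
      by (auto simp: w_def vadd_def fun_eq_iff)
    then have "N' y \<le> N' z + N w"
      using norm_on_R_vadd[OF N z w] by (simp add: N'_def)
    moreover have "N w \<le> (\<Sum>i<d. \<bar>w i\<bar> * c i)"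
      unfolding c_def by (rule norm_on_R_le_coords[OF N w])
    moreover have "(\<Sum>i<d. \<bar>w i\<bar> * c i) = (\<Sum>i<d. \<bar>y i - z i\<bar> * c i)"
      by (simp add: w_def)
    ultimately show ?thesis by simp
  qed
  have "continuous_on UNIV N'"
    unfolding continuous_on_def
  proof
    fix z :: "nat \<Rightarrow> real"
    have coord: "((\<lambda>y. y i) \<longlongrightarrow> z i) (at z)" for i
      using continuous_on_product_coordinates[of i] by (auto simp: continuous_on_def)
    have "((\<lambda>y. (\<Sum>i<d. \<bar>y i - z i\<bar> * c i)) \<longlongrightarrow> (\<Sum>i<d. \<bar>z i - z i\<bar> * c i)) (at z)"
      by (intro tendsto_intros coord)
    then have lim: "((\<lambda>y. (\<Sum>i<d. \<bar>y i - z i\<bar> * c i)) \<longlongrightarrow> 0) (at z)"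
      by simp
    have "\<bar>N' y - N' z\<bar> \<le> (\<Sum>i<d. \<bar>y i - z i\<bar> * c i)" for y
      using tri[of y z] tri[of z y] by (simp add: abs_minus_commute abs_le_iff)
    then have "((\<lambda>y. N' y - N' z) \<longlongrightarrow> 0) (at z)"
      by (intro Lim_null_comparison[OF always_eventually lim]) simp
    then show "(N' \<longlongrightarrow> N' z) (at z within UNIV)"
      by (simp add: LIM_zero_iff)
  qed
  then have "N' \<in> borel_measurable borel"
    by (rule borel_measurable_continuous_onI)
  then have N'_meas: "N' \<in> borel_measurable (Pi\<^sub>M UNIV (\<lambda>_::nat. borel :: real measure))"
    by (simp cong: measurable_cong_sets add: sets_PiM_equal_borel)
  have emb: "(\<lambda>x i. if i < d then x i else 0) \<in> measurable (borel_R d) (Pi\<^sub>M UNIV (\<lambda>_. borel))"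
  proof (rule measurable_PiM_single')
    show "(\<lambda>x. if i < d then x i else 0) \<in> borel_measurable (borel_R d)" for i
      by (cases "i < d") auto
  qed auto
  have "(\<lambda>x. N' (\<lambda>i. if i < d then x i else 0)) \<in> borel_measurable (borel_R d)"
    by (rule measurable_compose[OF emb N'_meas])
  moreover have "N' (\<lambda>i. if i < d then x i else 0) = N x" if "x \<in> space (borel_R d)" for x
  proof -
    have "restrict (\<lambda>i. if i < d then x i else 0) {..<d} = x"
      using that by (intro R_space_eqI[of _ d]) (auto simp: space_borel_R)
    then show ?thesis by (simp add: N'_def)
  qed
  ultimately show ?thesis
    by (simp cong: measurable_cong)
qed

section \<open>A norm whose balls are the dilates of a convex symmetric set\<close>

text \<open>Points with value \<open>undefined\<close> off \<open>{..<d}\<close> do not form a vector space under pointwise operations.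
  Linear algebra is therefore done in the space of all functions, in which the points extended by 0
  form a subspace.\<close>

interpretation real_fun: vector_space "\<lambda>(c::real) (x::nat \<Rightarrow> real) i. c * x i"
  by standard (auto simp: fun_eq_iff algebra_simps)

interpretation real_fun_pair: vector_space_pair
  "\<lambda>(c::real) (x::nat \<Rightarrow> real) i. c * x i" "\<lambda>(c::real) (x::nat \<Rightarrow> real) i. c * x i" ..

lemma sum_fun_apply: "(\<Sum>j\<in>J. f j) i = (\<Sum>j\<in>J. f j i :: real)"
  by (induction J rule: infinite_finite_induct) auto

text \<open>The equations for a subspace are obtained from a linear projection onto it: the subspace is where
  the projection is the identity.\<close>

lemma linear_projection_onto:
  assumes V: "V \<subseteq> R_space d" "vzero d \<in> V"
    and add: "\<And>x y. x \<in> V \<Longrightarrow> y \<in> V \<Longrightarrow> vadd d x y \<in> V"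
    and scale: "\<And>c x. x \<in> V \<Longrightarrow> vscale d c x \<in> V"
  obtains T :: "nat \<Rightarrow> nat \<Rightarrow> real" where
    "\<And>x. x \<in> R_space d \<Longrightarrow> (\<lambda>i\<in>{..<d}. \<Sum>j<d. T i j * x j) \<in> V"
    "\<And>x. x \<in> V \<Longrightarrow> (\<lambda>i\<in>{..<d}. \<Sum>j<d. T i j * x j) = x"
proof -
  define z where "z x = (\<lambda>i. if i < d then x i else (0::real))" for x
  let ?s = "\<lambda>(c::real) (x::nat \<Rightarrow> real) i. c * x i"
  have z_vzero: "0 = z (vzero d)"
    by (auto simp: z_def vzero_def fun_eq_iff)
  have z_vadd: "z x + z y = z (vadd d x y)" for x y
    by (auto simp: z_def vadd_def fun_eq_iff)
  have z_vscale: "?s c (z x) = z (vscale d c x)" for c x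
    by (auto simp: z_def vscale_def fun_eq_iff)
  have sub: "real_fun.subspace (z ` V)"
  proof (rule real_fun.subspaceI)
    show "0 \<in> z ` V"
      using V(2) z_vzero by auto
    show "x + y \<in> z ` V" if xy: "x \<in> z ` V" "y \<in> z ` V" for x y
    proof -
      from xy obtain v w where "v \<in> V" "w \<in> V" "x = z v" "y = z w" by blast
      then show ?thesis using add[of v w] by (simp add: z_vadd)
    qed
    show "?s c x \<in> z ` V" if x: "x \<in> z ` V" for c x
    proof -
      from x obtain v where v: "v \<in> V" "x = z v" by blast
      show ?thesis unfolding v z_vscale using scale[OF v(1)] by blast
    qed
  qed
  obtain P where P: "P ` UNIV \<subseteq> z ` V" "Vector_Spaces.linear ?s ?s P" "\<And>v. v \<in> z ` V \<Longrightarrow> P v = v"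
    using real_fun_pair.linear_exists_left_inverse_on[OF real_fun.linear_ident sub] by auto
  interpret P: Vector_Spaces.linear ?s ?s P by fact
  define T where "T i j = P (\<lambda>l. if l = j then 1 else 0) i" for i j
  have PT: "P (z x) i = (\<Sum>j<d. T i j * x j)" for x i
  proof -
    have "z x = (\<Sum>j<d. ?s (x j) (\<lambda>l. if l = j then 1 else 0))"
      by (auto simp: z_def fun_eq_iff sum_fun_apply if_distrib cong: if_cong)
    then have "P (z x) = (\<Sum>j<d. ?s (x j) (P (\<lambda>l. if l = j then 1 else 0)))"
      by (simp add: P.sum P.scale)
    then show ?thesis
      by (simp add: sum_fun_apply T_def mult.commute)
  qed
  have restrict_z: "(\<lambda>i\<in>{..<d}. z x i) = x" if "x \<in> R_space d" for x
    by (rule R_space_eqI[OF _ that]) (auto simp: z_def)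
  show thesis
  proof
    fix x assume "x \<in> R_space d"
    obtain v where v: "v \<in> V" "P (z x) = z v"
      using P(1) by blast
    then have "(\<lambda>i\<in>{..<d}. \<Sum>j<d. T i j * x j) = v"
      using restrict_z[of v] V by (auto simp flip: PT)
    with v show "(\<lambda>i\<in>{..<d}. \<Sum>j<d. T i j * x j) \<in> V" by simp
  next
    fix x assume x: "x \<in> V"
    then have "P (z x) = z x" by (intro P) auto
    then show "(\<lambda>i\<in>{..<d}. \<Sum>j<d. T i j * x j) = x"
      using restrict_z[of x] x V by (auto simp flip: PT)
  qed
qed

text \<open>The Minkowski functional of \<open>A\<close>; it is meaningful on the union of the positive dilates of \<open>A\<close>, which
  for a convex symmetric set is the linear span. Elsewhere the infimum is over the empty set.\<close>

definition gauge_R :: "nat \<Rightarrow> (nat \<Rightarrow> real) set \<Rightarrow> (nat \<Rightarrow> real) \<Rightarrow> real" where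
  "gauge_R d A x = Inf {s. 0 < s \<and> x \<in> dilate d s A}"

definition cone_R :: "nat \<Rightarrow> (nat \<Rightarrow> real) set \<Rightarrow> (nat \<Rightarrow> real) set" where
  "cone_R d A = {x. \<exists>s>0. x \<in> dilate d s A}"

locale convex_symmetric_R =
  fixes d :: nat and A :: "(nat \<Rightarrow> real) set"
  assumes convex: "convex_R d A" and symmetric: "symmetric_R d A" and nonempty: "A \<noteq> {}"
begin

lemma subset_R_space: "A \<subseteq> R_space d"
  using convex by (simp add: convex_R_def)

lemma mem_dilate: "0 < s \<Longrightarrow> x \<in> dilate d s A \<longleftrightarrow> x \<in> R_space d \<and> vscale d (1 / s) x \<in> A"
  using mem_dilate_iff[OF _ subset_R_space] by simp

lemma vzero_mem: "vzero d \<in> A"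
  using vzero_mem_convex_symmetric[OF convex symmetric] nonempty by auto

lemma dilate_mono:
  assumes "x \<in> dilate d s A" "0 < s" "s \<le> t"
  shows "x \<in> dilate d t A"
proof -
  have "vscale d (s / t) (vscale d (1 / s) x) \<in> A"
  proof (rule convex_symmetric_shrink[OF convex symmetric])
    show "vscale d (1 / s) x \<in> A"
      using assms(1,2) by (simp add: mem_dilate)
    show "\<bar>s / t\<bar> \<le> 1"
      using assms(2,3) by simp
  qed
  then show ?thesis
    using assms by (simp add: mem_dilate vscale_vscale)
qed

lemma dilate_vadd:
  assumes "x \<in> dilate d s A" "y \<in> dilate d t A" "0 < s" "0 < t"
  shows "vadd d x y \<in> dilate d (s + t) A"
proof -
  have "s / (s + t) + t / (s + t) = 1"
    using assms by (simp add: add_divide_distrib[symmetric])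
  then have "(\<lambda>i\<in>{..<d}. (s / (s + t)) * vscale d (1 / s) x i + (t / (s + t)) * vscale d (1 / t) y i) \<in> A"
    using assms(1,2) assms(3,4)
    by (intro convex_R_combine[OF convex]) (simp_all add: mem_dilate)
  also have "(\<lambda>i\<in>{..<d}. (s / (s + t)) * vscale d (1 / s) x i + (t / (s + t)) * vscale d (1 / t) y i)
      = vscale d (1 / (s + t)) (vadd d x y)"
    using assms(3,4) by (auto simp: vscale_def vadd_def fun_eq_iff add_divide_distrib)
  finally show ?thesis
    using assms by (simp add: mem_dilate vadd_in_R_space)
qed

lemma dilate_vscale:
  assumes "x \<in> dilate d s A" "0 < s" "\<bar>c\<bar> \<le> t" "0 < t"
  shows "vscale d c x \<in> dilate d (t * s) A"
proof -
  have "vscale d (c / t) (vscale d (1 / s) x) \<in> A"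
  proof (rule convex_symmetric_shrink[OF convex symmetric])
    show "vscale d (1 / s) x \<in> A"
      using assms(1,2) by (simp add: mem_dilate)
    show "\<bar>c / t\<bar> \<le> 1"
      using assms(3,4) by simp
  qed
  then show ?thesis
    using assms by (simp add: mem_dilate vscale_vscale vscale_in_R_space)
qed

lemma cone_subset: "cone_R d A \<subseteq> R_space d"
  by (auto simp: cone_R_def mem_dilate)

lemma subset_cone: "A \<subseteq> cone_R d A"
proof
  fix x assume "x \<in> A"
  then have "x \<in> dilate d 1 A"
    using subset_R_space by (subst mem_dilate) (auto simp: vscale_one)
  then show "x \<in> cone_R d A"
    unfolding cone_R_def using zero_less_one by blast
qed

lemma cone_vadd: "x \<in> cone_R d A \<Longrightarrow> y \<in> cone_R d A \<Longrightarrow> vadd d x y \<in> cone_R d A"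
  unfolding cone_R_def using dilate_vadd add_pos_pos by blast

lemma cone_vscale:
  assumes "x \<in> cone_R d A"
  shows "vscale d c x \<in> cone_R d A"
proof -
  obtain s where "0 < s" "x \<in> dilate d s A"
    using assms by (auto simp: cone_R_def)
  then have "vscale d c x \<in> dilate d ((\<bar>c\<bar> + 1) * s) A"
    by (intro dilate_vscale) auto
  moreover have "0 < (\<bar>c\<bar> + 1) * s"
    using \<open>0 < s\<close> by simp
  ultimately show ?thesis
    unfolding cone_R_def by blast
qed

lemma gauge_le: "x \<in> dilate d s A \<Longrightarrow> 0 < s \<Longrightarrow> gauge_R d A x \<le> s"
  unfolding gauge_R_def by (intro cInf_lower bdd_belowI[of _ 0]) auto

lemma gauge_nonneg: "x \<in> cone_R d A \<Longrightarrow> 0 \<le> gauge_R d A x"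
  unfolding gauge_R_def cone_R_def by (intro cInf_greatest) auto

lemma gauge_less:
  assumes "x \<in> cone_R d A" "gauge_R d A x < t"
  shows "0 < t" "x \<in> dilate d t A"
proof -
  obtain s where "0 < s" "x \<in> dilate d s A" "s < t"
    using cInf_lessD[of "{s. 0 < s \<and> x \<in> dilate d s A}" t] assms
    by (auto simp: gauge_R_def cone_R_def)
  then show "0 < t" "x \<in> dilate d t A"
    using dilate_mono[of x s t] by auto
qed

lemma gauge_le_one: "x \<in> A \<Longrightarrow> gauge_R d A x \<le> 1"
  using subset_R_space by (intro gauge_le) (auto simp: mem_dilate vscale_one)

lemma gauge_vadd:
  assumes "x \<in> cone_R d A" "y \<in> cone_R d A"
  shows "gauge_R d A (vadd d x y) \<le> gauge_R d A x + gauge_R d A y"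
proof (rule field_le_epsilon)
  fix e :: real assume "0 < e"
  then have e: "gauge_R d A x < gauge_R d A x + e/2" "gauge_R d A y < gauge_R d A y + e/2" by auto
  show "gauge_R d A (vadd d x y) \<le> gauge_R d A x + gauge_R d A y + e"
    using gauge_le[OF dilate_vadd] gauge_less[OF assms(1) e(1)] gauge_less[OF assms(2) e(2)]
    by fastforce
qed

lemma gauge_vscale_le:
  assumes x: "x \<in> cone_R d A"
  shows "gauge_R d A (vscale d c x) \<le> \<bar>c\<bar> * gauge_R d A x"
proof (rule field_le_epsilon)
  fix e :: real assume e: "0 < e"
  define g where "g = gauge_R d A x"
  have g: "0 \<le> g" using gauge_nonneg[OF x] by (simp add: g_def)
  (* Both the factor and the gauge are enlarged, so that the case c = 0 needs no separate treatment. *)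
  define r where "r = min 1 (e / (g + \<bar>c\<bar> + 1))"
  have r: "0 < r" "r \<le> 1" "r * (g + \<bar>c\<bar> + 1) \<le> e"
  proof -
    have D: "0 < g + \<bar>c\<bar> + 1" using g by simp
    then show "0 < r" "r \<le> 1" using e by (auto simp: r_def)
    have "r \<le> e / (g + \<bar>c\<bar> + 1)" by (simp add: r_def)
    then show "r * (g + \<bar>c\<bar> + 1) \<le> e" using D by (simp add: pos_le_divide_eq)
  qed
  have "gauge_R d A x < g + r" using r by (simp add: g_def)
  from gauge_less[OF x this] have "gauge_R d A (vscale d c x) \<le> (\<bar>c\<bar> + r) * (g + r)"
    using r by (intro gauge_le dilate_vscale) auto
  also have "\<dots> \<le> \<bar>c\<bar> * g + e"
  proof -
    have "r * r \<le> r" using mult_left_mono[OF r(2), of r] r(1) by simp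
    moreover have "(\<bar>c\<bar> + r) * (g + r) = \<bar>c\<bar> * g + (r * (g + \<bar>c\<bar> + 1) - r) + r * r"
      by (simp add: algebra_simps)
    ultimately show ?thesis using r(3) by linarith
  qed
  finally show "gauge_R d A (vscale d c x) \<le> \<bar>c\<bar> * gauge_R d A x + e"
    by (simp add: g_def)
qed

lemma gauge_vscale:
  assumes x: "x \<in> cone_R d A"
  shows "gauge_R d A (vscale d c x) = \<bar>c\<bar> * gauge_R d A x"
proof (cases "c = 0")
  case True
  then show ?thesis
    using gauge_vscale_le[OF x, of c] gauge_nonneg[OF cone_vscale[OF x, of c]] by simp
next
  case False
  have "gauge_R d A x = gauge_R d A (vscale d (1 / c) (vscale d c x))"
    using False x cone_subset by (auto simp: vscale_vscale vscale_one)
  also have "\<dots> \<le> \<bar>1 / c\<bar> * gauge_R d A (vscale d c x)"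
    by (rule gauge_vscale_le[OF cone_vscale[OF x]])
  finally have "\<bar>c\<bar> * gauge_R d A x \<le> gauge_R d A (vscale d c x)"
    using False by (simp add: field_simps)
  with gauge_vscale_le[OF x, of c] show ?thesis by simp
qed

lemma gauge_eq_0:
  assumes x: "x \<in> cone_R d A" "gauge_R d A x = 0"
    and bounded: "\<And>a i. a \<in> A \<Longrightarrow> i < d \<Longrightarrow> \<bar>a i\<bar> \<le> R"
  shows "x = vzero d"
proof (rule R_space_eqI)
  show "x \<in> R_space d" using x cone_subset by auto
  fix i assume i: "i < d"
  have "\<bar>x i\<bar> \<le> 0 + e" if "0 < e" for e
  proof -
    have R: "0 \<le> R" using bounded[OF vzero_mem i] by simp
    define s where "s = e / (R + 1)"
    have s: "0 < s" using R that by (simp add: s_def)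
    then have "vscale d (1 / s) x \<in> A"
      using gauge_less(2)[OF x(1)] x(2) by (auto simp: mem_dilate)
    from bounded[OF this i] have "\<bar>x i\<bar> \<le> s * R"
      using s i by (simp add: vscale_def field_simps abs_mult)
    also have "\<dots> \<le> e" using R that by (simp add: s_def field_simps)
    finally show ?thesis by simp
  qed
  then have "\<bar>x i\<bar> \<le> 0" by (rule field_le_epsilon)
  then show "x i = vzero d i" using i by (simp add: vzero_def)
qed (rule vzero_in_R_space)

text \<open>The set may lie in a proper subspace \<open>V\<close> (the cone over it), where its gauge is a norm; along a
  linear complement of \<open>V\<close> any norm will do. The subspace comes with linear equations, because
  the equations are what a Gaussian measure can be tested against.\<close>

lemma exists_norm:
  assumes bounded: "\<And>a i. a \<in> A \<Longrightarrow> i < d \<Longrightarrow> \<bar>a i\<bar> \<le> R"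
  obtains N :: "(nat \<Rightarrow> real) \<Rightarrow> real" and U :: "nat \<Rightarrow> nat \<Rightarrow> real" where
    "norm_on_R d N" "\<And>x. x \<in> A \<Longrightarrow> N x \<le> 1"
    "\<And>x i. x \<in> A \<Longrightarrow> i < d \<Longrightarrow> (\<Sum>j<d. U i j * x j) = 0"
    "\<And>x s. x \<in> R_space d \<Longrightarrow> (\<And>i. i < d \<Longrightarrow> (\<Sum>j<d. U i j * x j) = 0) \<Longrightarrow> N x < s \<Longrightarrow> x \<in> dilate d s A"
proof -
  have "vzero d \<in> cone_R d A" using vzero_mem subset_cone by auto
  from linear_projection_onto[OF cone_subset this cone_vadd cone_vscale]
  obtain T where T: "\<And>x. x \<in> R_space d \<Longrightarrow> (\<lambda>i\<in>{..<d}. \<Sum>j<d. T i j * x j) \<in> cone_R d A"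
    "\<And>x. x \<in> cone_R d A \<Longrightarrow> (\<lambda>i\<in>{..<d}. \<Sum>j<d. T i j * x j) = x" by blast
  define P where "P x = (\<lambda>i\<in>{..<d}. \<Sum>j<d. T i j * x j)" for x
  have P: "P x \<in> cone_R d A" if "x \<in> R_space d" for x
    using T(1)[OF that] by (simp add: P_def)
  have P_id: "P x = x" if "x \<in> cone_R d A" for x
    using T(2)[OF that] by (simp add: P_def)
  have P_vadd: "P (vadd d x y) = vadd d (P x) (P y)" for x y
    by (auto simp: P_def vadd_def fun_eq_iff algebra_simps sum.distrib)
  have P_vscale: "P (vscale d c x) = vscale d c (P x)" for c x
    by (auto simp: P_def vscale_def fun_eq_iff algebra_simps sum_distrib_left)
  define U where "U i j = (if j = i then 1 else 0) - T i j" for i j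
  have U: "(\<Sum>j<d. U i j * x j) = x i - P x i" if "i < d" for x i
    using that by (simp add: U_def P_def left_diff_distrib sum_subtractf if_distrib[of "\<lambda>c. c * _"] cong: if_cong)
  \<comment> \<open>the Minkowski functional of the component in the span, plus the \<open>l\<^sub>1\<close> norm of the complementary one\<close>
  define N where "N x = gauge_R d A (P x) + (\<Sum>i<d. \<bar>x i - P x i\<bar>)" for x
  have N_cone: "N x = gauge_R d A x" if "x \<in> cone_R d A" for x
    using P_id[OF that] by (simp add: N_def)
  have norm: "norm_on_R d N"
    unfolding norm_on_R_def
  proof (intro conjI ballI allI)
    fix x assume x: "x \<in> R_space d"
    have s: "0 \<le> (\<Sum>i<d. \<bar>x i - P x i\<bar>)" by (simp add: sum_nonneg)
    with gauge_nonneg[OF P[OF x]] show "0 \<le> N x" by (simp add: N_def)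
    show "N x = 0 \<longleftrightarrow> x = vzero d"
    proof
      assume "N x = 0"
      then have g: "gauge_R d A (P x) = 0" and "(\<Sum>i<d. \<bar>x i - P x i\<bar>) = 0"
        unfolding N_def add_nonneg_eq_0_iff[OF gauge_nonneg[OF P[OF x]] s] by auto
      then have "\<And>i. i < d \<Longrightarrow> x i = P x i"
        by (simp add: sum_nonneg_eq_0_iff)
      then have "x = P x"
        using x P[OF x] cone_subset by (intro R_space_eqI) auto
      with gauge_eq_0[OF P[OF x] g, of R] bounded show "x = vzero d" by simp
    next
      assume "x = vzero d"
      moreover have "vscale d 0 (vzero d) = vzero d"
        by (auto simp: vscale_def vzero_def)
      ultimately show "N x = 0"
        using N_cone[OF \<open>vzero d \<in> cone_R d A\<close>] gauge_vscale[OF \<open>vzero d \<in> cone_R d A\<close>, of 0] by simp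
    qed
    show "N (vscale d c x) = \<bar>c\<bar> * N x" for c
    proof -
      have "(\<Sum>i<d. \<bar>vscale d c x i - vscale d c (P x) i\<bar>) = (\<Sum>i<d. \<bar>c\<bar> * \<bar>x i - P x i\<bar>)"
        by (intro sum.cong) (auto simp: vscale_def abs_mult[symmetric] algebra_simps)
      then show ?thesis
        by (simp add: N_def P_vscale gauge_vscale[OF P[OF x]] distrib_left sum_distrib_left)
    qed
    show "N (vadd d x y) \<le> N x + N y" if y: "y \<in> R_space d" for y
    proof -
      have "(\<Sum>i<d. \<bar>vadd d x y i - vadd d (P x) (P y) i\<bar>)
          \<le> (\<Sum>i<d. \<bar>x i - P x i\<bar> + \<bar>y i - P y i\<bar>)"
        by (intro sum_mono) (auto simp: vadd_def)
      then show ?thesis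
        using gauge_vadd[OF P[OF x] P[OF y]] by (simp add: N_def P_vadd sum.distrib)
    qed
  qed
  show thesis
  proof (rule that[OF norm, of U])
    fix x assume x: "x \<in> A"
    then have xc: "x \<in> cone_R d A" using subset_cone by auto
    show "N x \<le> 1" using gauge_le_one[OF x] N_cone[OF xc] by simp
    show "(\<Sum>j<d. U i j * x j) = 0" if "i < d" for i
      using P_id[OF xc] U[OF that] by simp
  next
    fix x s assume x: "x \<in> R_space d" and eqs: "\<And>i. i < d \<Longrightarrow> (\<Sum>j<d. U i j * x j) = 0" and "N x < s"
    have "x = P x"
      using eqs U P[OF x] cone_subset x by (intro R_space_eqI) auto
    then have "x \<in> cone_R d A" using P[OF x] by simp
    with N_cone gauge_less(2) \<open>N x < s\<close> show "x \<in> dilate d s A" by simp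
  qed
qed

end

section \<open>Centered Gaussian measures\<close>

text \<open>Scaling a standard normal variable covers the degenerate case as well, so that characteristic
  functions and moments can be read off from the standard normal law.\<close>

lemma centered_normal_eq_distr:
  assumes "0 \<le> \<sigma>"
  shows "centered_normal \<sigma> = distr std_normal_distribution borel (\<lambda>x. \<sigma> * x)"
proof -
  interpret N: prob_space std_normal_distribution
    by (rule prob_space_normal_density) simp
  show ?thesis
  proof (cases "\<sigma> = 0")
    case True
    have "distr std_normal_distribution borel (\<lambda>x. 0) = return borel (0::real)"
      by (rule N.distr_const) simp
    then show ?thesis using True by (simp add: centered_normal_def)
  next
    case False
    have "distributed std_normal_distribution lborel (\<lambda>x. x) (normal_density 0 1)"
      by (auto simp: distributed_def distr_id2)
    then have "distributed std_normal_distribution lborel (\<lambda>x. 0 + \<sigma> * x) (normal_density (0 + \<sigma> * 0) (\<bar>\<sigma>\<bar> * 1))"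
      using False by (intro N.normal_density_affine) auto
    then have "distr std_normal_distribution lborel (\<lambda>x. \<sigma> * x) = density lborel (normal_density 0 \<sigma>)"
      using assms by (simp add: distributed_def)
    moreover have "distr std_normal_distribution lborel (\<lambda>x. \<sigma> * x) = distr std_normal_distribution borel (\<lambda>x. \<sigma> * x)"
      by (rule distr_cong) auto
    ultimately show ?thesis using False by (simp add: centered_normal_def)
  qed
qed

lemma real_distribution_centered_normal:
  assumes "0 \<le> \<sigma>"
  shows "real_distribution (centered_normal \<sigma>)"
proof -
  interpret N: prob_space std_normal_distribution
    by (rule prob_space_normal_density) simp
  show ?thesis
    unfolding centered_normal_eq_distr[OF assms] real_distribution_def real_distribution_axioms_def
    by (auto intro!: N.prob_space_distr)
qed

lemma char_centered_normal:
  assumes "0 \<le> \<sigma>"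
  shows "char (centered_normal \<sigma>) u = complex_of_real (exp (- (\<sigma>\<^sup>2 * u\<^sup>2) / 2))"
proof -
  have "char (centered_normal \<sigma>) u = char std_normal_distribution (\<sigma> * u)"
    unfolding centered_normal_eq_distr[OF assms] char_def
    by (subst integral_distr) (auto simp: mult_ac)
  then show ?thesis
    by (simp add: char_std_normal_distribution power_mult_distrib)
qed

lemma integrable_centered_normal_powr:
  assumes "0 \<le> \<sigma>" "0 < q"
  shows "integrable (centered_normal \<sigma>) (\<lambda>x. \<bar>x\<bar> powr q)"
proof -
  interpret N: prob_space std_normal_distribution
    by (rule prob_space_normal_density) simp
  \<comment> \<open>integer moments are known; a real power is at most 1 plus the next integer power\<close>
  define k where "k = nat \<lceil>q\<rceil>"
  have "integrable std_normal_distribution (\<lambda>x. \<bar>x\<bar> ^ k)"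
    by (subst integrable_density) (auto intro: integrable_std_normal_moment_abs)
  then have dom: "integrable std_normal_distribution (\<lambda>x. 1 + \<bar>\<sigma>\<bar> ^ k * \<bar>x\<bar> ^ k)"
    by simp
  have "\<bar>\<sigma> * x\<bar> powr q \<le> 1 + \<bar>\<sigma>\<bar> ^ k * \<bar>x\<bar> ^ k" for x
  proof (cases "\<bar>\<sigma> * x\<bar> \<le> 1")
    case True
    then have "\<bar>\<sigma> * x\<bar> powr q \<le> 1" using assms by (intro powr_le1) auto
    then show ?thesis by (simp add: add_increasing2)
  next
    case False
    then have "\<bar>\<sigma> * x\<bar> powr q \<le> \<bar>\<sigma> * x\<bar> powr real k"
      by (intro powr_mono) (auto simp: k_def, linarith)
    also have "\<dots> = \<bar>\<sigma>\<bar> ^ k * \<bar>x\<bar> ^ k"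
      using False by (subst powr_realpow) (auto simp: abs_mult power_mult_distrib)
    finally show ?thesis by simp
  qed
  then have "integrable std_normal_distribution (\<lambda>x. \<bar>\<sigma> * x\<bar> powr q)"
    by (intro Bochner_Integration.integrable_bound[OF dom]) (auto intro!: AE_I2 order_trans[OF _ abs_ge_self])
  then show ?thesis
    unfolding centered_normal_eq_distr[OF assms(1)] by (subst integrable_distr_eq) auto
qed

lemma centered_normal_atom:
  assumes "0 \<le> \<sigma>" "measure (centered_normal \<sigma>) {0} > 0"
  shows "\<sigma> = 0"
proof (rule ccontr)
  assume "\<sigma> \<noteq> 0"
  moreover have "AE x in lborel. x \<notin> {0::real}"
    by (simp add: AE_lborel_singleton)
  then have "emeasure (density lborel (\<lambda>x. ennreal (normal_density 0 \<sigma> x))) {0} = 0"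
    by (subst emeasure_density) (auto simp: nn_integral_0_iff_AE indicator_def elim!: eventually_mono)
  ultimately show False
    using assms(2) by (simp add: centered_normal_def measure_def)
qed

lemma centered_gaussian_prob_space: "centered_gaussian d \<mu> \<Longrightarrow> prob_space \<mu>"
  by (simp add: centered_gaussian_def)

lemma centered_gaussian_sets: "centered_gaussian d \<mu> \<Longrightarrow> sets \<mu> = sets (borel_R d)"
  by (simp add: centered_gaussian_def)

lemma centered_gaussian_space: "centered_gaussian d \<mu> \<Longrightarrow> space \<mu> = R_space d"
  by (metis centered_gaussian_sets sets_eq_imp_space_eq space_borel_R)

lemma centered_gaussian_functional:
  assumes "centered_gaussian d \<mu>"
  obtains \<sigma> where "0 \<le> \<sigma>" "distr \<mu> borel (\<lambda>x. \<Sum>i<d. t i * x i) = centered_normal \<sigma>"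
  using assms unfolding centered_gaussian_def by blast

lemma measurable_functional: "(\<lambda>x. \<Sum>i<d. t i * x i) \<in> borel_measurable (borel_R d)"
  by (intro borel_measurable_sum borel_measurable_times measurable_coord) auto

lemma centered_gaussian_integrable_coord:
  assumes \<mu>: "centered_gaussian d \<mu>" and "i < d" "0 < q"
  shows "integrable \<mu> (\<lambda>x. \<bar>x i\<bar> powr q)"
proof -
  obtain \<sigma> where \<sigma>: "0 \<le> \<sigma>" "distr \<mu> borel (\<lambda>x. \<Sum>j<d. (if j = i then 1 else 0) * x j) = centered_normal \<sigma>"
    by (rule centered_gaussian_functional[OF \<mu>])
  have "(\<Sum>j<d. (if j = i then 1 else 0) * x j) = x i" for x :: "nat \<Rightarrow> real"
    using \<open>i < d\<close> by (simp add: if_distrib[of "\<lambda>c. c * _"] cong: if_cong)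
  then have eq: "distr \<mu> borel (\<lambda>x. x i) = centered_normal \<sigma>"
    using \<sigma>(2) by simp
  have m: "(\<lambda>x. x i) \<in> borel_measurable \<mu>"
    using measurable_coord[OF \<open>i < d\<close>] by (simp cong: measurable_cong_sets add: centered_gaussian_sets[OF \<mu>])
  show ?thesis
    using integrable_centered_normal_powr[OF \<sigma>(1) \<open>0 < q\<close>] integrable_distr_eq[OF m, of "\<lambda>y. \<bar>y\<bar> powr q"]
    by (simp add: eq)
qed

text \<open>The law of a linear functional is a centered normal law, and such a law has no atom unless it is
  the point mass at 0.\<close>

lemma centered_gaussian_zero_one:
  assumes \<mu>: "centered_gaussian d \<mu>"
    and A: "A \<in> sets (borel_R d)" "0 < measure \<mu> A"
    and zero: "\<And>x. x \<in> A \<Longrightarrow> (\<Sum>i<d. t i * x i) = 0"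
  shows "AE x in \<mu>. (\<Sum>i<d. t i * x i) = 0"
proof -
  interpret \<mu>: prob_space \<mu> using \<mu> by (rule centered_gaussian_prob_space)
  let ?f = "\<lambda>x. \<Sum>i<d. t i * x i"
  obtain \<sigma> where \<sigma>: "0 \<le> \<sigma>" "distr \<mu> borel ?f = centered_normal \<sigma>"
    by (rule centered_gaussian_functional[OF \<mu>])
  have f: "?f \<in> borel_measurable \<mu>"
    using measurable_functional by (simp cong: measurable_cong_sets add: centered_gaussian_sets[OF \<mu>])
  have A_sub: "A \<subseteq> ?f -` {0} \<inter> space \<mu>"
    using zero sets.sets_into_space[OF A(1)] by (auto simp: space_borel_R centered_gaussian_space[OF \<mu>])
  have vimage: "measure (distr \<mu> borel ?f) {0} = measure \<mu> (?f -` {0} \<inter> space \<mu>)"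
    by (rule measure_distr[OF f]) simp
  have "measure \<mu> A \<le> measure (distr \<mu> borel ?f) {0}"
    unfolding vimage using A_sub by (intro \<mu>.finite_measure_mono measurable_sets[OF f]) auto
  then have "\<sigma> = 0"
    using \<sigma> A(2) by (intro centered_normal_atom) auto
  then have "measure (distr \<mu> borel ?f) {0} = 1"
    using \<sigma>(2) by (simp add: centered_normal_def measure_return)
  then have "AE x in \<mu>. x \<in> ?f -` {0} \<inter> space \<mu>"
    unfolding vimage by (intro \<mu>.AE_in_set_eq_1[THEN iffD2] measurable_sets[OF f]) auto
  then show ?thesis
    by (rule AE_mp) auto
qed

lemma indep_vars_PiM_coordinates:
  assumes "I \<noteq> {}" and M: "\<And>i. i \<in> I \<Longrightarrow> prob_space (M i)"
  shows "prob_space.indep_vars (Pi\<^sub>M I M) M (\<lambda>i \<omega>. \<omega> i) I"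
proof -
  interpret P: prob_space "Pi\<^sub>M I M" by (rule prob_space_PiM[OF M])
  have "distr (Pi\<^sub>M I M) (Pi\<^sub>M I M) (\<lambda>\<omega>. \<lambda>i\<in>I. \<omega> i) = distr (Pi\<^sub>M I M) (Pi\<^sub>M I M) (\<lambda>\<omega>. \<omega>)"
    by (intro distr_cong) (auto simp: space_PiM)
  also have "\<dots> = Pi\<^sub>M I M" by (rule distr_id2) simp
  also have "\<dots> = Pi\<^sub>M I (\<lambda>i. distr (Pi\<^sub>M I M) (M i) (\<lambda>\<omega>. \<omega> i))"
    by (intro PiM_cong distr_PiM_component[symmetric] M) auto
  finally show ?thesis
    by (subst P.indep_vars_iff_distr_eq_PiM'[OF assms(1)]) auto
qed

section \<open>Independent copies placed in consecutive blocks of coordinates\<close>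

definition blocks :: "nat \<Rightarrow> nat \<Rightarrow> (nat \<Rightarrow> nat \<Rightarrow> real) \<Rightarrow> nat \<Rightarrow> real" where
  "blocks d k w = (\<lambda>m\<in>{..<k * d}. w (m div d) (m mod d))"

definition block :: "nat \<Rightarrow> nat \<Rightarrow> (nat \<Rightarrow> real) \<Rightarrow> nat \<Rightarrow> real" where
  "block d j x = (\<lambda>i\<in>{..<d}. x (j * d + i))"

definition block_power :: "nat \<Rightarrow> nat \<Rightarrow> (nat \<Rightarrow> real) measure \<Rightarrow> (nat \<Rightarrow> real) measure" where
  "block_power d k \<mu> = distr (Pi\<^sub>M {..<k} (\<lambda>_. \<mu>)) (borel_R (k * d)) (blocks d k)"

lemma block_index_less:
  assumes "j < k" "i < (d::nat)"
  shows "j * d + i < k * d"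
proof -
  have "j * d + i < j * d + d" using assms by simp
  also have "\<dots> = Suc j * d" by simp
  also have "\<dots> \<le> k * d" using assms by (intro mult_right_mono) auto
  finally show ?thesis .
qed

lemma block_blocks:
  assumes "j < k" "w j \<in> R_space d"
  shows "block d j (blocks d k w) = w j"
  using assms(2)
  by (intro R_space_eqI[of _ d]) (auto simp: block_def blocks_def block_index_less[OF assms(1)])

lemma block_in_R_space: "block d j x \<in> R_space d"
  by (auto simp: block_def)

lemma block_measurable:
  assumes "j < k"
  shows "block d j \<in> measurable (borel_R (k * d)) (borel_R d)"
  unfolding block_def
  by (intro measurable_restrict measurable_coord block_index_less[OF assms]) auto

lemma blocks_measurable:
  assumes "sets \<mu> = sets (borel_R d)"
  shows "blocks d k \<in> measurable (Pi\<^sub>M {..<k} (\<lambda>_. \<mu>)) (borel_R (k * d))"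
  unfolding blocks_def
proof (intro measurable_restrict)
  fix m assume "m \<in> {..<k * d}"
  then have m: "m div d < k" "m mod d < d"
    by (auto simp: less_mult_imp_div_less intro!: mod_less_divisor) (metis gr0I mult_0_right not_less0)
  have "(\<lambda>x. x (m mod d)) \<in> borel_measurable \<mu>"
    using measurable_coord[OF m(2)] by (simp cong: measurable_cong_sets add: assms)
  then show "(\<lambda>w. w (m div d) (m mod d)) \<in> borel_measurable (Pi\<^sub>M {..<k} (\<lambda>_. \<mu>))"
    using m(1) by (intro measurable_compose[OF measurable_component_singleton]) auto
qed

text \<open>A linear functional of the concatenated vector is a sum of independent centered normal
  variables, some of which may be degenerate; characteristic functions treat all cases alike.\<close>

lemma centered_gaussian_block_power:
  assumes \<mu>: "centered_gaussian d \<mu>" and "1 \<le> k"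
  shows "centered_gaussian (k * d) (block_power d k \<mu>)"
proof -
  let ?P = "Pi\<^sub>M {..<k} (\<lambda>_. \<mu>)"
  have [simp]: "prob_space \<mu>" using \<mu> by (rule centered_gaussian_prob_space)
  interpret P: prob_space ?P by (rule prob_space_PiM) simp
  note sets = centered_gaussian_sets[OF \<mu>]
  note bm = blocks_measurable[OF sets, of k]
  have "\<exists>\<sigma>\<ge>0. distr (block_power d k \<mu>) borel (\<lambda>x. \<Sum>m<k * d. t m * x m) = centered_normal \<sigma>" for t
  proof -
    define S where "S j x = (\<Sum>i<d. t (j * d + i) * x i)" for j and x :: "nat \<Rightarrow> real"
    have S_meas: "S j \<in> borel_measurable \<mu>" for j
      unfolding S_def using measurable_functional by (simp cong: measurable_cong_sets add: sets)
    have "\<exists>\<sigma>\<ge>0. distr \<mu> borel (S j) = centered_normal \<sigma>" for j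
      using centered_gaussian_functional[OF \<mu>, of "\<lambda>i. t (j * d + i)"] unfolding S_def by metis
    then obtain \<sigma> where \<sigma>: "\<And>j. 0 \<le> \<sigma> j" "\<And>j. distr \<mu> borel (S j) = centered_normal (\<sigma> j)"
      by metis
    have split: "(\<Sum>m<k * d. t m * blocks d k w m) = (\<Sum>j<k. S j (w j))" for w
    proof -
      have "(\<Sum>m<k * d. t m * blocks d k w m) = (\<Sum>j<k. \<Sum>m\<in>{j * d..<j * d + d}. t m * blocks d k w m)"
        by (rule sum.nat_group[symmetric])
      also have "\<dots> = (\<Sum>j<k. \<Sum>i<d. t (j * d + i) * blocks d k w (j * d + i))"
        using sum.shift_bounds_nat_ivl[of "\<lambda>m. t m * blocks d k w m" 0 "_ * d" d]
        by (intro sum.cong[OF refl, of "{..<k}"]) (simp add: add.commute lessThan_atLeast0)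
      also have "\<dots> = (\<Sum>j<k. S j (w j))"
        unfolding S_def by (intro sum.cong refl) (auto simp: blocks_def block_index_less)
      finally show ?thesis .
    qed
    have eq: "distr (block_power d k \<mu>) borel (\<lambda>x. \<Sum>m<k * d. t m * x m)
        = distr ?P borel (\<lambda>w. \<Sum>j<k. S j (w j))"
      unfolding block_power_def
      by (subst distr_distr[OF measurable_functional bm]) (simp add: comp_def split)
    have "P.indep_vars (\<lambda>_. borel) (\<lambda>j w. S j (w j)) {..<k}"
      using \<open>1 \<le> k\<close> S_meas
      by (intro P.indep_vars_compose2[OF indep_vars_PiM_coordinates]) (auto simp: lessThan_empty_iff)
    from P.char_distr_sum[OF this]
    have char_eq: "char (distr ?P borel (\<lambda>w. \<Sum>j<k. S j (w j))) u
        = (\<Prod>j<k. char (distr ?P borel (\<lambda>w. S j (w j))) u)" for u .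
    have "distr ?P borel (\<lambda>w. S j (w j)) = centered_normal (\<sigma> j)" if "j < k" for j
    proof -
      have "distr ?P borel (\<lambda>w. S j (w j)) = distr (distr ?P \<mu> (\<lambda>w. w j)) borel (S j)"
        using that S_meas by (subst distr_distr) (auto simp: comp_def)
      also have "distr ?P \<mu> (\<lambda>w. w j) = \<mu>"
        using that by (intro distr_PiM_component) auto
      finally show ?thesis using \<sigma> by simp
    qed
    then have "char (distr ?P borel (\<lambda>w. \<Sum>j<k. S j (w j))) u
        = complex_of_real (exp (\<Sum>j<k. - ((\<sigma> j)\<^sup>2 * u\<^sup>2) / 2))" for u
      by (simp add: char_eq char_centered_normal[OF \<sigma>(1)] exp_sum flip: of_real_prod)
    moreover have "(\<Sum>j<k. - ((\<sigma> j)\<^sup>2 * u\<^sup>2) / 2) = - ((sqrt (\<Sum>j<k. (\<sigma> j)\<^sup>2))\<^sup>2 * u\<^sup>2) / 2" for u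
      by (simp add: sum_nonneg sum_distrib_right sum_negf sum_divide_distrib)
    ultimately have "char (distr ?P borel (\<lambda>w. \<Sum>j<k. S j (w j))) = char (centered_normal (sqrt (\<Sum>j<k. (\<sigma> j)\<^sup>2)))"
      by (auto simp: fun_eq_iff char_centered_normal sum_nonneg)
    moreover have "(\<lambda>w. \<Sum>j<k. S j (w j)) \<in> borel_measurable ?P"
      using S_meas by (intro borel_measurable_sum measurable_compose[OF measurable_component_singleton]) auto
    then have "real_distribution (distr ?P borel (\<lambda>w. \<Sum>j<k. S j (w j)))"
      unfolding real_distribution_def real_distribution_axioms_def by (auto intro!: P.prob_space_distr)
    ultimately have "distr ?P borel (\<lambda>w. \<Sum>j<k. S j (w j)) = centered_normal (sqrt (\<Sum>j<k. (\<sigma> j)\<^sup>2))"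
      by (intro Levy_uniqueness real_distribution_centered_normal) (auto intro: sum_nonneg)
    then show ?thesis
      unfolding eq by (intro exI[of _ "sqrt (\<Sum>j<k. (\<sigma> j)\<^sup>2)"]) (auto intro: sum_nonneg)
  qed
  then show ?thesis
    using P.prob_space_distr[OF bm] by (simp add: centered_gaussian_def block_power_def)
qed

lemma all_blocks_sets:
  assumes "K \<in> sets (borel_R d)"
  shows "{x \<in> R_space (k * d). \<forall>j<k. block d j x \<in> K} \<in> sets (borel_R (k * d))"
proof -
  have "{x \<in> R_space (k * d). \<forall>j<k. block d j x \<in> K}
      = {x \<in> space (borel_R (k * d)). \<forall>j\<in>{..<k}. block d j x \<in> K}"
    by (auto simp: space_borel_R)
  also have "\<dots> \<in> sets (borel_R (k * d))"
  proof (intro sets.sets_Collect_finite_All)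
    fix j assume "j \<in> {..<k}"
    then show "{x \<in> space (borel_R (k * d)). block d j x \<in> K} \<in> sets (borel_R (k * d))"
      using assms by (intro measurable_sets_Collect[OF block_measurable]) auto
  qed simp
  finally show ?thesis .
qed

lemma measure_block_power:
  assumes \<mu>: "centered_gaussian d \<mu>" and K: "K \<in> sets (borel_R d)"
  shows "measure (block_power d k \<mu>) {x \<in> R_space (k * d). \<forall>j<k. block d j x \<in> K} = measure \<mu> K ^ k"
proof -
  let ?P = "Pi\<^sub>M {..<k} (\<lambda>_. \<mu>)"
  interpret \<mu>: prob_space \<mu> using \<mu> by (rule centered_gaussian_prob_space)
  interpret PP: finite_product_prob_space "\<lambda>_::nat. \<mu>" "{..<k}" by unfold_locales simp
  note sets = centered_gaussian_sets[OF \<mu>]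
  note bm = blocks_measurable[OF sets, of k]
  have K': "K \<in> sets \<mu>" using K sets by simp
  note meas = all_blocks_sets[OF K, of k]
  have "blocks d k -` {x \<in> R_space (k * d). \<forall>j<k. block d j x \<in> K} \<inter> space ?P = PiE {..<k} (\<lambda>_. K)"
  proof -
    have K_sub: "K \<subseteq> R_space d" using sets.sets_into_space[OF K] by (simp add: space_borel_R)
    have "blocks d k w \<in> R_space (k * d)" for w
      by (auto simp: blocks_def)
    then show ?thesis
      using K_sub block_blocks[of _ k _ d]
      by (auto simp: space_PiM centered_gaussian_space[OF \<mu>] PiE_iff)
  qed
  then have "measure (block_power d k \<mu>) {x \<in> R_space (k * d). \<forall>j<k. block d j x \<in> K} = measure ?P (PiE {..<k} (\<lambda>_. K))"
    unfolding block_power_def by (simp add: measure_distr[OF bm meas])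
  also have "\<dots> = (\<Prod>j<k. measure \<mu> K)"
    using K' by (intro PP.prob_times) auto
  finally show ?thesis by simp
qed

section \<open>Moments of minima of independent copies\<close>

lemma Lq_norm_powr:
  assumes "0 < q"
  shows "Lq_norm M q W powr q = (\<integral>\<omega>. \<bar>W \<omega>\<bar> powr q \<partial>M)"
proof -
  have "0 \<le> (\<integral>\<omega>. \<bar>W \<omega>\<bar> powr q \<partial>M)" by simp
  then show ?thesis
    using assms by (simp add: Lq_norm_def powr_powr)
qed

context prob_space
begin

lemma min_copies_measurable:
  assumes "1 \<le> n" "W \<in> borel_measurable M"
  shows "min_copies n W \<in> borel_measurable (Pi\<^sub>M {..<n} (\<lambda>_. M))"
  unfolding min_copies_def
  using assms by (intro borel_measurable_Min measurable_compose[OF measurable_component_singleton]) auto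

lemma min_copies_le: "i < n \<Longrightarrow> min_copies n W \<omega> \<le> W (\<omega> i)"
  unfolding min_copies_def by (intro Min_le) auto

lemma min_copies_greater: "1 \<le> n \<Longrightarrow> a < min_copies n W \<omega> \<longleftrightarrow> (\<forall>i<n. a < W (\<omega> i))"
  unfolding min_copies_def by (subst Min_gr_iff) (auto simp: lessThan_empty_iff)

lemma min_copies_nonneg:
  assumes "1 \<le> n" "\<And>\<omega>. \<omega> \<in> space M \<Longrightarrow> 0 \<le> W \<omega>" "\<omega> \<in> space (Pi\<^sub>M {..<n} (\<lambda>_. M))"
  shows "0 \<le> min_copies n W \<omega>"
  unfolding min_copies_def
  using assms by (subst Min_ge_iff) (auto simp: lessThan_empty_iff space_PiM)

lemma prob_greater:
  fixes W :: "'a \<Rightarrow> real"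
  assumes "W \<in> borel_measurable M"
  shows "prob {\<omega> \<in> space M. a < W \<omega>} = 1 - prob {\<omega> \<in> space M. W \<omega> \<le> a}"
proof -
  have "{\<omega> \<in> space M. a < W \<omega>} = space M - {\<omega> \<in> space M. W \<omega> \<le> a}" by auto
  then show ?thesis
    using assms by (simp add: prob_compl)
qed

lemma prob_PiM_coordinates:
  assumes "finite I" "J \<subseteq> I" and S: "\<And>i. i \<in> J \<Longrightarrow> S i \<in> events"
  shows "measure (Pi\<^sub>M I (\<lambda>_. M)) {\<omega> \<in> space (Pi\<^sub>M I (\<lambda>_. M)). \<forall>i\<in>J. \<omega> i \<in> S i} = (\<Prod>i\<in>J. prob (S i))"
proof -
  interpret P: finite_product_prob_space "\<lambda>_. M" I by unfold_locales (rule \<open>finite I\<close>)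
  define T where "T i = (if i \<in> J then S i else space M)" for i
  have T: "T i \<in> events" "T i \<subseteq> space M" for i
    using S sets.sets_into_space[OF S] by (auto simp: T_def)
  have "{\<omega> \<in> space (Pi\<^sub>M I (\<lambda>_. M)). \<forall>i\<in>J. \<omega> i \<in> S i} = PiE I T"
  proof (intro set_eqI iffI)
    fix \<omega> assume "\<omega> \<in> {\<omega> \<in> space (Pi\<^sub>M I (\<lambda>_. M)). \<forall>i\<in>J. \<omega> i \<in> S i}"
    then show "\<omega> \<in> PiE I T"
      by (auto simp: space_PiM PiE_iff T_def)
  next
    fix \<omega> assume \<omega>: "\<omega> \<in> PiE I T"
    then have "\<omega> \<in> space (Pi\<^sub>M I (\<lambda>_. M))"
      using T(2) by (fastforce simp: space_PiM PiE_iff)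
    moreover have "\<omega> i \<in> S i" if "i \<in> J" for i
      using PiE_mem[OF \<omega>, of i] that \<open>J \<subseteq> I\<close> by (auto simp: T_def)
    ultimately show "\<omega> \<in> {\<omega> \<in> space (Pi\<^sub>M I (\<lambda>_. M)). \<forall>i\<in>J. \<omega> i \<in> S i}"
      by simp
  qed
  then have "measure (Pi\<^sub>M I (\<lambda>_. M)) {\<omega> \<in> space (Pi\<^sub>M I (\<lambda>_. M)). \<forall>i\<in>J. \<omega> i \<in> S i} = (\<Prod>i\<in>I. prob (T i))"
    using T by (simp add: P.prob_times)
  also have "\<dots> = (\<Prod>i\<in>J. prob (S i))"
    using \<open>finite I\<close> \<open>J \<subseteq> I\<close>
    by (intro prod.mono_neutral_cong_right) (auto simp: T_def prob_space)
  finally show ?thesis .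
qed

lemma integral_indicator_greater:
  fixes W :: "'a \<Rightarrow> real"
  assumes "W \<in> borel_measurable M"
  shows "integrable M (\<lambda>\<omega>. indicator {a<..} (W \<omega>) :: real)"
    and "(\<integral>\<omega>. indicator {a<..} (W \<omega>) \<partial>M) = 1 - prob {\<omega> \<in> space M. W \<omega> \<le> a}"
proof -
  have ind: "indicator {a<..} (W \<omega>) = (indicator {\<omega> \<in> space M. a < W \<omega>} \<omega> :: real)"
    if "\<omega> \<in> space M" for \<omega>
    using that by (auto simp: indicator_def)
  have "integrable M (\<lambda>\<omega>. indicator {\<omega> \<in> space M. a < W \<omega>} \<omega> :: real)"
    using assms by (intro integrable_real_indicator) (auto simp: emeasure_eq_measure)
  then show "integrable M (\<lambda>\<omega>. indicator {a<..} (W \<omega>) :: real)"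
    using ind by (simp cong: Bochner_Integration.integrable_cong)
  have "(\<integral>\<omega>. indicator {a<..} (W \<omega>) \<partial>M) = (\<integral>\<omega>. indicator {\<omega> \<in> space M. a < W \<omega>} \<omega> \<partial>M :: real)"
    using ind by (intro Bochner_Integration.integral_cong) auto
  also have "\<dots> = prob ({\<omega> \<in> space M. a < W \<omega>} \<inter> space M)"
    by (rule Bochner_Integration.integral_indicator)
  also have "{\<omega> \<in> space M. a < W \<omega>} \<inter> space M = {\<omega> \<in> space M. a < W \<omega>}"
    by blast
  finally show "(\<integral>\<omega>. indicator {a<..} (W \<omega>) \<partial>M) = 1 - prob {\<omega> \<in> space M. W \<omega> \<le> a}"
    by (simp add: prob_greater[OF assms])
qed

lemma integrable_first_copy:
  fixes n :: nat and f :: "'a \<Rightarrow> real"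
  assumes "1 \<le> n" "integrable M f"
  shows "integrable (Pi\<^sub>M {..<n} (\<lambda>_. M)) (\<lambda>\<omega>. f (\<omega> 0))"
proof -
  have n: "0 \<in> {..<n}" using \<open>1 \<le> n\<close> by simp
  have M: "distr (Pi\<^sub>M {..<n} (\<lambda>_. M)) M (\<lambda>\<omega>. \<omega> 0) = M"
    by (rule distr_PiM_component[OF prob_space_axioms n])
  have "integrable (distr (Pi\<^sub>M {..<n} (\<lambda>_. M)) M (\<lambda>\<omega>. \<omega> 0)) f"
    using assms by (simp add: M)
  then show ?thesis
    by (rule integrable_distr[OF measurable_component_singleton[OF n]])
qed

text \<open>The minimum exceeds \<open>a\<close> exactly where all copies do, and the copies are independent.\<close>

lemma min_norm_lower_bound:
  assumes "0 < q" "0 \<le> a" "1 \<le> n"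
    and W: "W \<in> borel_measurable M" "\<And>\<omega>. \<omega> \<in> space M \<Longrightarrow> 0 \<le> W \<omega>" "integrable M (\<lambda>\<omega>. W \<omega> powr q)"
  shows "a powr q * (1 - prob {\<omega> \<in> space M. W \<omega> \<le> a}) ^ n \<le> min_norm M q n W powr q"
proof -
  interpret PP: product_prob_space "\<lambda>_::nat. M" by unfold_locales
  let ?P = "Pi\<^sub>M {..<n} (\<lambda>_. M)"
  have nonneg: "0 \<le> min_copies n W \<omega>" if "\<omega> \<in> space ?P" for \<omega>
    using \<open>1 \<le> n\<close> W(2) that by (rule min_copies_nonneg)
  have int: "integrable ?P (\<lambda>\<omega>. \<bar>min_copies n W \<omega>\<bar> powr q)"
  proof (rule Bochner_Integration.integrable_bound[OF integrable_first_copy[OF \<open>1 \<le> n\<close> W(3)]])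
    show "(\<lambda>\<omega>. \<bar>min_copies n W \<omega>\<bar> powr q) \<in> borel_measurable ?P"
      using min_copies_measurable[OF \<open>1 \<le> n\<close> W(1)] by measurable
    show "AE \<omega> in ?P. norm (\<bar>min_copies n W \<omega>\<bar> powr q) \<le> norm (W (\<omega> 0) powr q)"
      using nonneg min_copies_le[of 0 n W] \<open>1 \<le> n\<close> \<open>0 < q\<close>
      by (intro AE_I2) (auto intro!: powr_mono2)
  qed
  let ?ind = "\<lambda>\<omega>. \<Prod>i<n. indicator {a<..} (W (\<omega> i)) :: real"
  have "a powr q * (1 - prob {\<omega> \<in> space M. W \<omega> \<le> a}) ^ n = (\<integral>\<omega>. a powr q * ?ind \<omega> \<partial>?P)"
    using PP.product_integral_prod[of "{..<n}" "\<lambda>_ x. indicator {a<..} (W x) :: real"]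
    by (simp add: integral_indicator_greater[OF W(1)])
  also have "\<dots> \<le> (\<integral>\<omega>. \<bar>min_copies n W \<omega>\<bar> powr q \<partial>?P)"
  proof (rule integral_mono'[OF int])
    fix \<omega> assume "\<omega> \<in> space ?P"
    note nonneg = nonneg[OF this]
    show "a powr q * ?ind \<omega> \<le> \<bar>min_copies n W \<omega>\<bar> powr q"
    proof (cases "\<forall>i<n. a < W (\<omega> i)")
      case True
      then have "a < min_copies n W \<omega>" using min_copies_greater[OF \<open>1 \<le> n\<close>] by auto
      with True show ?thesis
        using assms by (auto intro!: powr_mono2)
    next
      case False
      then have zero: "?ind \<omega> = 0" by (intro prod_zero) (auto simp: indicator_def)
      show ?thesis unfolding zero by simp
    qed
  qed simp
  finally show ?thesis
    by (simp add: min_norm_def Lq_norm_powr[OF \<open>0 < q\<close>])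
qed

text \<open>Where the minimum exceeds 1, all copies do, and the minimum is at most the first of them. Hence a
  crude moment bound for one copy, damped by the other copies, is enough.\<close>

lemma min_norm_upper_bound:
  assumes "0 < q" "1 \<le> n"
    and W: "W \<in> borel_measurable M" "\<And>\<omega>. \<omega> \<in> space M \<Longrightarrow> 0 \<le> W \<omega>" "integrable M (\<lambda>\<omega>. W \<omega> powr q)"
  shows "min_norm M q n W powr q
    \<le> 1 + (1 - prob {\<omega> \<in> space M. W \<omega> \<le> 1}) ^ (n - 1) * (\<integral>\<omega>. W \<omega> powr q \<partial>M)"
proof -
  interpret PP: product_prob_space "\<lambda>_::nat. M" by unfold_locales
  let ?P = "Pi\<^sub>M {..<n} (\<lambda>_. M)"
  interpret P: prob_space ?P by (rule prob_space_PiM) (rule prob_space_axioms)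
  \<comment> \<open>a product over the copies, so that its integral factorizes\<close>
  define f where "f i x = (if i = 0 then W x powr q else indicator {1<..} (W x))" for i :: nat and x
  have int_f: "integrable M (f i)" for i
    using W(3) integral_indicator_greater[OF W(1)] by (cases "i = 0") (auto simp: f_def[abs_def])
  have n: "{..<n} = insert 0 {1..<n}" using \<open>1 \<le> n\<close> by auto
  have int_prod: "integrable ?P (\<lambda>\<omega>. \<Prod>i<n. f i (\<omega> i))"
    by (intro PP.product_integrable_prod int_f) auto
  have "(\<integral>\<omega>. \<bar>min_copies n W \<omega>\<bar> powr q \<partial>?P) \<le> (\<integral>\<omega>. 1 + (\<Prod>i<n. f i (\<omega> i)) \<partial>?P)"
  proof (rule integral_mono')
    show "integrable ?P (\<lambda>\<omega>. 1 + (\<Prod>i<n. f i (\<omega> i)))"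
      using int_prod by (intro Bochner_Integration.integrable_add) auto
    fix \<omega> assume \<omega>: "\<omega> \<in> space ?P"
    have f0: "0 \<le> (\<Prod>i<n. f i (\<omega> i))"
      by (intro prod_nonneg) (auto simp: f_def)
    then show "0 \<le> 1 + (\<Prod>i<n. f i (\<omega> i))" by simp
    have nonneg: "0 \<le> min_copies n W \<omega>"
      using \<open>1 \<le> n\<close> W(2) \<omega> by (rule min_copies_nonneg)
    show "\<bar>min_copies n W \<omega>\<bar> powr q \<le> 1 + (\<Prod>i<n. f i (\<omega> i))"
    proof (cases "1 < min_copies n W \<omega>")
      case True
      then have "\<forall>i<n. 1 < W (\<omega> i)" using min_copies_greater[OF \<open>1 \<le> n\<close>] by auto
      then have "(\<Prod>i<n. f i (\<omega> i)) = W (\<omega> 0) powr q"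
        by (simp add: n f_def)
      moreover have "\<bar>min_copies n W \<omega>\<bar> powr q \<le> W (\<omega> 0) powr q"
        using nonneg min_copies_le[of 0 n W \<omega>] \<open>1 \<le> n\<close> \<open>0 < q\<close> by (auto intro!: powr_mono2)
      ultimately show ?thesis by simp
    next
      case False
      then have "\<bar>min_copies n W \<omega>\<bar> powr q \<le> 1"
        using nonneg \<open>0 < q\<close> by (intro powr_le1) auto
      with f0 show ?thesis by simp
    qed
  qed
  also have "\<dots> = 1 + (\<Prod>i<n. integral\<^sup>L M (f i))"
    using int_prod by (simp add: PP.product_integral_prod[OF _ int_f] P.prob_space)
  also have "(\<Prod>i<n. integral\<^sup>L M (f i)) = (\<integral>\<omega>. W \<omega> powr q \<partial>M) * (\<Prod>i\<in>{1..<n}. 1 - prob {\<omega> \<in> space M. W \<omega> \<le> 1})"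
    unfolding n by (simp add: f_def[abs_def] integral_indicator_greater[OF W(1)])
  finally show ?thesis
    by (simp add: min_norm_def Lq_norm_powr[OF \<open>0 < q\<close>] mult.commute)
qed

end

section \<open>Comparison of norms of Gaussian vectors\<close>

definition min_comparison :: "real \<Rightarrow> real \<Rightarrow> bool" where
  "min_comparison q C \<longleftrightarrow> (\<forall>d\<ge>1. \<forall>L\<ge>1. \<forall>N :: nat \<Rightarrow> (nat \<Rightarrow> real) \<Rightarrow> real.
    \<forall>M :: sample measure. \<forall>G :: nat \<Rightarrow> sample \<Rightarrow> nat \<Rightarrow> real.
      (\<forall>l\<in>{1..L}. norm_on_R d (N l)) \<longrightarrow> iid_centered_gaussian d M G {0..L} \<longrightarrow>
      (\<forall>n\<ge>1. min_norm M q n (\<lambda>\<omega>. MAX l\<in>{1..L}. N l (G 0 \<omega>))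
           \<le> C * min_norm M q n (\<lambda>\<omega>. MAX l\<in>{1..L}. N l (G l \<omega>))))"

lemma min_comparisonD:
  fixes M :: "sample measure" and G :: "nat \<Rightarrow> sample \<Rightarrow> nat \<Rightarrow> real"
  assumes "min_comparison q C" "1 \<le> d" "1 \<le> L" "1 \<le> n"
    and "\<And>l. l \<in> {1..L} \<Longrightarrow> norm_on_R d (N l)" "iid_centered_gaussian d M G {0..L}"
  shows "min_norm M q n (\<lambda>\<omega>. MAX l\<in>{1..L}. N l (G 0 \<omega>))
    \<le> C * min_norm M q n (\<lambda>\<omega>. MAX l\<in>{1..L}. N l (G l \<omega>))"
  by (rule assms(1)[unfolded min_comparison_def, rule_format, OF assms(2,3,5,6,4)])

lemma iid_centered_gaussian_coordinates:
  assumes \<nu>: "centered_gaussian d \<nu>" and "I \<noteq> {}"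
  shows "iid_centered_gaussian d (Pi\<^sub>M I (\<lambda>_. \<nu>)) (\<lambda>i \<omega>. \<omega> i) I"
proof -
  have prob: "prob_space \<nu>" using \<nu> by (rule centered_gaussian_prob_space)
  interpret P: prob_space "Pi\<^sub>M I (\<lambda>_. \<nu>)" by (rule prob_space_PiM) (rule prob)
  note sets = centered_gaussian_sets[OF \<nu>]
  have id: "(\<lambda>x. x) \<in> measurable \<nu> (borel_R d)"
    using sets by (simp cong: measurable_cong_sets)
  have "P.indep_vars (\<lambda>_. borel_R d) (\<lambda>i \<omega>. \<omega> i) I"
    using P.indep_vars_compose2[OF indep_vars_PiM_coordinates[OF \<open>I \<noteq> {}\<close> prob], of "\<lambda>_ x. x" "\<lambda>_. borel_R d"] id
    by simp
  moreover have "distr (Pi\<^sub>M I (\<lambda>_. \<nu>)) (borel_R d) (\<lambda>\<omega>. \<omega> i) = \<nu>" if "i \<in> I" for i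
  proof -
    have "distr (Pi\<^sub>M I (\<lambda>_. \<nu>)) (borel_R d) (\<lambda>\<omega>. \<omega> i) = distr (Pi\<^sub>M I (\<lambda>_. \<nu>)) \<nu> (\<lambda>\<omega>. \<omega> i)"
      using sets by (intro distr_cong) auto
    also have "\<dots> = \<nu>" using that prob by (intro distr_PiM_component)
    finally show ?thesis .
  qed
  ultimately show ?thesis
    unfolding iid_centered_gaussian_def using P.prob_space_axioms \<nu> by auto
qed

text \<open>Taking the maximum over blocks norm by norm, instead of treating each block separately, keeps the
  functions norms: a norm of one block alone vanishes on all the other blocks.\<close>

definition block_max :: "nat \<Rightarrow> nat \<Rightarrow> ((nat \<Rightarrow> real) \<Rightarrow> real) \<Rightarrow> (nat \<Rightarrow> real) \<Rightarrow> real" where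
  "block_max d k N x = (MAX j\<in>{..<k}. N (block d j x))"

lemma block_max_le_iff: "1 \<le> k \<Longrightarrow> block_max d k N x \<le> t \<longleftrightarrow> (\<forall>j<k. N (block d j x) \<le> t)"
  unfolding block_max_def by (subst Max_le_iff) (auto simp: lessThan_empty_iff)

lemma le_block_max: "j < k \<Longrightarrow> N (block d j x) \<le> block_max d k N x"
  unfolding block_max_def by (intro Max_ge) auto

lemma block_max_attained:
  assumes "1 \<le> k"
  obtains j where "j < k" "block_max d k N x = N (block d j x)"
proof -
  have "block_max d k N x \<in> (\<lambda>j. N (block d j x)) ` {..<k}"
    unfolding block_max_def using assms by (intro Max_in) (auto simp: lessThan_empty_iff)
  then show ?thesis using that by auto
qed

lemma norm_on_R_block_max:
  assumes N: "norm_on_R d N" and "1 \<le> k"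
  shows "norm_on_R (k * d) (block_max d k N)"
proof -
  have scale: "block d j (vscale (k * d) c x) = vscale d c (block d j x)" if "j < k" for j c x
    by (auto simp: block_def vscale_def fun_eq_iff block_index_less[OF that])
  have add: "block d j (vadd (k * d) x y) = vadd d (block d j x) (block d j y)" if "j < k" for j x y
    by (auto simp: block_def vadd_def fun_eq_iff block_index_less[OF that])
  have zero: "block d j (vzero (k * d)) = vzero d" if "j < k" for j
    by (auto simp: block_def vzero_def fun_eq_iff block_index_less[OF that])
  have nonneg: "0 \<le> N (block d j x)" for j x
    by (rule norm_on_R_nonneg[OF N block_in_R_space])
  have max_nonneg: "0 \<le> block_max d k N x" for x
    using nonneg[of 0 x] le_block_max[of 0 k N d x] \<open>1 \<le> k\<close> by simp
  show ?thesis
    unfolding norm_on_R_def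
  proof (intro conjI ballI allI)
    fix x assume x: "x \<in> R_space (k * d)"
    show "0 \<le> block_max d k N x" by (rule max_nonneg)
    show "block_max d k N x = 0 \<longleftrightarrow> x = vzero (k * d)"
    proof
      assume "block_max d k N x = 0"
      then have "N (block d j x) = 0" if "j < k" for j
        using nonneg[of j x] le_block_max[OF that, of N d x] by simp
      then have blk: "block d j x = vzero d" if "j < k" for j
        using N block_in_R_space that by (simp add: norm_on_R_def)
      show "x = vzero (k * d)"
      proof (rule R_space_eqI[OF x vzero_in_R_space])
        fix m assume m: "m < k * d"
        then have "0 < d" by (cases d) auto
        then have md: "m div d < k" "m mod d < d" using m by (auto simp: less_mult_imp_div_less)
        then have "block d (m div d) x (m mod d) = 0"
          by (simp add: blk vzero_def)
        then show "x m = vzero (k * d) m"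
          using m md by (simp add: block_def vzero_def)
      qed
    next
      assume "x = vzero (k * d)"
      then have "block_max d k N x \<le> 0"
        using \<open>1 \<le> k\<close> by (simp add: block_max_le_iff zero norm_on_R_vzero[OF N])
      with max_nonneg[of x] show "block_max d k N x = 0" by simp
    qed
    show "block_max d k N (vscale (k * d) c x) = \<bar>c\<bar> * block_max d k N x" for c
    proof (rule antisym)
      show "block_max d k N (vscale (k * d) c x) \<le> \<bar>c\<bar> * block_max d k N x"
        using \<open>1 \<le> k\<close> by (simp add: block_max_le_iff scale norm_on_R_vscale[OF N block_in_R_space] le_block_max mult_left_mono)
      obtain j where "j < k" "block_max d k N x = N (block d j x)"
        by (rule block_max_attained[OF \<open>1 \<le> k\<close>])
      then show "\<bar>c\<bar> * block_max d k N x \<le> block_max d k N (vscale (k * d) c x)"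
        using le_block_max[of j k N d "vscale (k * d) c x"]
        by (simp add: scale norm_on_R_vscale[OF N block_in_R_space])
    qed
    show "block_max d k N (vadd (k * d) x y) \<le> block_max d k N x + block_max d k N y" for y
      unfolding block_max_le_iff[OF \<open>1 \<le> k\<close>]
    proof (intro allI impI)
      fix j assume "j < k"
      then show "N (block d j (vadd (k * d) x y)) \<le> block_max d k N x + block_max d k N y"
        using norm_on_R_vadd[OF N block_in_R_space block_in_R_space, of j x j y]
          le_block_max[of j k N d x] le_block_max[of j k N d y] by (simp add: add)
    qed
  qed
qed

lemma distr_block_power:
  assumes \<mu>: "centered_gaussian d \<mu>" and "j < k"
  shows "distr (block_power d k \<mu>) (borel_R d) (block d j) = \<mu>"
proof -
  let ?P = "Pi\<^sub>M {..<k} (\<lambda>_. \<mu>)"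
  note sets = centered_gaussian_sets[OF \<mu>]
  have "distr (block_power d k \<mu>) (borel_R d) (block d j)
      = distr ?P (borel_R d) (block d j \<circ> blocks d k)"
    unfolding block_power_def
    by (rule distr_distr[OF block_measurable[OF \<open>j < k\<close>] blocks_measurable[OF sets]])
  also have "\<dots> = distr ?P \<mu> (\<lambda>w. w j)"
    using \<open>j < k\<close> sets
    by (intro distr_cong) (auto simp: space_PiM centered_gaussian_space[OF \<mu>] intro!: block_blocks)
  also have "\<dots> = \<mu>"
    using \<open>j < k\<close> centered_gaussian_prob_space[OF \<mu>] by (intro distr_PiM_component) auto
  finally show ?thesis .
qed

text \<open>The norm is at most \<open>d\<close> times the largest of the terms \<open>\<bar>x\<^sub>i\<bar> N(e\<^sub>i)\<close>, so its \<open>q\<close>-th power is at most a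
  multiple of the sum of the \<open>q\<close>-th powers of the coordinates.\<close>

lemma norm_on_R_integrable_powr:
  assumes \<mu>: "centered_gaussian d \<mu>" and N: "norm_on_R d N" and "0 < q"
  shows "integrable \<mu> (\<lambda>x. N x powr q)"
proof -
  define c where "c i = N (\<lambda>j\<in>{..<d}. if j = i then 1 else 0)" for i
  have c: "0 \<le> c i" for i
    unfolding c_def by (rule norm_on_R_nonneg[OF N]) auto
  have dom: "integrable \<mu> (\<lambda>x. real d powr q * (\<Sum>i<d. c i powr q * \<bar>x i\<bar> powr q))"
    using centered_gaussian_integrable_coord[OF \<mu> _ \<open>0 < q\<close>]
    by (intro integrable_mult_right Bochner_Integration.integrable_sum) auto
  have meas: "N \<in> borel_measurable \<mu>"
    using norm_on_R_measurable[OF N] by (simp cong: measurable_cong_sets add: centered_gaussian_sets[OF \<mu>])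
  have le: "N x powr q \<le> real d powr q * (\<Sum>i<d. c i powr q * \<bar>x i\<bar> powr q)"
    if x: "x \<in> R_space d" for x
  proof (cases "d = 0")
    case True
    then have "x = vzero d" by (intro R_space_eqI[OF x vzero_in_R_space]) auto
    then show ?thesis using True norm_on_R_vzero[OF N] by simp
  next
    case False
    define m where "m = (MAX i\<in>{..<d}. \<bar>x i\<bar> * c i)"
    have "m \<in> (\<lambda>i. \<bar>x i\<bar> * c i) ` {..<d}"
      unfolding m_def using False by (intro Max_in) (auto simp: lessThan_empty_iff)
    then obtain i where i: "i < d" "m = \<bar>x i\<bar> * c i" by auto
    have "N x \<le> (\<Sum>i<d. \<bar>x i\<bar> * c i)"
      unfolding c_def by (rule norm_on_R_le_coords[OF N x])
    also have "\<dots> \<le> real (card {..<d}) * m"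
      unfolding m_def by (intro sum_bounded_above Max_ge) auto
    finally have "N x \<le> real d * m" by simp
    then have "N x powr q \<le> (real d * m) powr q"
      using norm_on_R_nonneg[OF N x] \<open>0 < q\<close> by (intro powr_mono2) auto
    also have "\<dots> = real d powr q * (c i powr q * \<bar>x i\<bar> powr q)"
      using i c by (simp add: powr_mult mult_ac)
    also have "\<dots> \<le> real d powr q * (\<Sum>i<d. c i powr q * \<bar>x i\<bar> powr q)"
      using i by (intro mult_left_mono member_le_sum) auto
    finally show ?thesis .
  qed
  show ?thesis
  proof (rule Bochner_Integration.integrable_bound[OF dom])
    show "(\<lambda>x. N x powr q) \<in> borel_measurable \<mu>"
      using meas by measurable
    show "AE x in \<mu>. norm (N x powr q) \<le> norm (real d powr q * (\<Sum>i<d. c i powr q * \<bar>x i\<bar> powr q))"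
    proof (rule AE_I2)
      fix x assume "x \<in> space \<mu>"
      then have "N x powr q \<le> real d powr q * (\<Sum>i<d. c i powr q * \<bar>x i\<bar> powr q)"
        by (intro le) (simp add: centered_gaussian_space[OF \<mu>])
      then show "norm (N x powr q) \<le> norm (real d powr q * (\<Sum>i<d. c i powr q * \<bar>x i\<bar> powr q))"
        by simp
    qed
  qed
qed

text \<open>With \<open>n\<close> of the order \<open>k b\<^sup>-\<^sup>k\<close>, the damping factor on the right beats the linear growth in \<open>k\<close>,
  while \<open>n a\<^sup>k\<close> still tends to 0 because \<open>a < b\<close>.\<close>

lemma tensor_power_contradiction:
  fixes a b B u v :: real
  assumes "0 \<le> a" "a < b" "b \<le> 1" "0 \<le> B" "0 \<le> u" "0 \<le> v"
    and ineq: "\<And>k n. 1 \<le> k \<Longrightarrow> 1 \<le> n \<Longrightarrow>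
      u * (1 - a ^ k) ^ n \<le> v * (1 + (1 - b ^ k) ^ (n - 1) * (real k * B))"
  shows "u \<le> v"
proof -
  have b: "0 < b" using assms by simp
  define \<rho> where "\<rho> = a / b"
  have \<rho>: "0 \<le> \<rho>" "\<rho> < 1" using assms b by (auto simp: \<rho>_def)
  have bound: "u * (1 - (real k * \<rho> ^ k + 2 * a ^ k)) \<le> v * (1 + real k * exp (- 1) ^ k * B)"
    if "1 \<le> k" for k
  proof -
    \<comment> \<open>\<open>m\<close> is \<open>n - 1\<close>, the number of copies that provide the damping\<close>
    define m where "m = nat \<lceil>real k / b ^ k\<rceil>"
    have m: "real k / b ^ k \<le> real m" "real m \<le> real k / b ^ k + 1"
      using b by (auto simp: m_def)
    have bk: "0 < b ^ k" "b ^ k \<le> 1" and ak: "0 \<le> a ^ k" "a ^ k \<le> 1"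
      using assms b by (auto intro: power_le_one)
    have "(1 - b ^ k) ^ m \<le> exp (- (b ^ k)) ^ m"
      using bk exp_ge_add_one_self[of "- (b ^ k)"] by (intro power_mono) auto
    also have "\<dots> = exp (- (real m * b ^ k))"
      by (simp flip: exp_of_nat_mult)
    also have "\<dots> \<le> exp (- real k)"
      using m(1) bk by (simp add: field_simps)
    also have "\<dots> = exp (- 1) ^ k"
      by (simp flip: exp_of_nat_mult)
    finally have damp: "(1 - b ^ k) ^ m \<le> exp (- 1) ^ k" .
    have "real (Suc m) * a ^ k \<le> (real k / b ^ k + 2) * a ^ k"
      using m(2) ak by (intro mult_right_mono) auto
    also have "\<dots> = real k * \<rho> ^ k + 2 * a ^ k"
      by (simp add: \<rho>_def power_divide algebra_simps)
    finally have "1 - (real k * \<rho> ^ k + 2 * a ^ k) \<le> 1 + real (Suc m) * (- (a ^ k))"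
      by simp
    also have "\<dots> \<le> (1 + (- (a ^ k))) ^ Suc m"
      using ak by (intro Bernoulli_inequality) simp
    finally have "u * (1 - (real k * \<rho> ^ k + 2 * a ^ k)) \<le> u * (1 - a ^ k) ^ Suc m"
      using \<open>0 \<le> u\<close> by (intro mult_left_mono) auto
    also have "\<dots> \<le> v * (1 + (1 - b ^ k) ^ m * (real k * B))"
      using ineq[OF that, of "Suc m"] by simp
    also have "\<dots> \<le> v * (1 + exp (- 1) ^ k * (real k * B))"
      using damp assms by (intro mult_left_mono add_left_mono mult_right_mono) auto
    finally show ?thesis by (simp add: mult_ac)
  qed
  have "a ^ 1 < 1" using assms by simp
  then have lim_a: "(\<lambda>k. a ^ k) \<longlonglongrightarrow> 0" using assms by (intro LIMSEQ_realpow_zero) auto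
  have lim_\<rho>: "(\<lambda>k. real k * \<rho> ^ k) \<longlonglongrightarrow> 0"
    using powser_times_n_limit_0[of \<rho>] \<rho> by simp
  have lim_e: "(\<lambda>k. real k * exp (- 1) ^ k) \<longlonglongrightarrow> 0"
    using powser_times_n_limit_0[of "exp (- 1 :: real)"] by simp
  have "(\<lambda>k. u * (1 - (real k * \<rho> ^ k + 2 * a ^ k))) \<longlonglongrightarrow> u * (1 - (0 + 2 * 0))"
    by (intro tendsto_intros lim_a lim_\<rho>)
  moreover have "(\<lambda>k. v * (1 + real k * exp (- 1) ^ k * B)) \<longlonglongrightarrow> v * (1 + 0 * B)"
    by (intro tendsto_intros lim_e)
  ultimately have "u * (1 - (0 + 2 * 0)) \<le> v * (1 + 0 * B)"
    by (rule LIMSEQ_le) (use bound in blast)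
  then show ?thesis by simp
qed

text \<open>The two maxima to be compared differ only in which coordinate of the product space is fed to
  which norm; \<open>h\<close> records that choice. The \<open>q\<close>-th power of the maximum is at most the sum of the \<open>q\<close>-th
  powers over all norms and blocks, and in each term the argument of \<open>N\<^sub>l\<close> has law \<open>\<mu>\<close>.\<close>

lemma block_max_moment:
  fixes h :: "nat \<Rightarrow> nat"
  assumes \<mu>: "centered_gaussian d \<mu>" and N: "\<And>l. l \<in> {1..L} \<Longrightarrow> norm_on_R d (N l)"
    and "1 \<le> k" "1 \<le> L" "0 < q" and h: "\<And>l. l \<in> {1..L} \<Longrightarrow> h l \<in> {0..L}"
  defines "M \<equiv> Pi\<^sub>M {0..L} (\<lambda>_. block_power d k \<mu>)"
    and "W \<equiv> \<lambda>\<omega>. MAX l\<in>{1..L}. block_max d k (N l) (\<omega> (h l))"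
  shows "W \<in> borel_measurable M" "\<And>\<omega>. \<omega> \<in> space M \<Longrightarrow> 0 \<le> W \<omega>"
    "integrable M (\<lambda>\<omega>. W \<omega> powr q)"
    "(\<integral>\<omega>. W \<omega> powr q \<partial>M) \<le> real k * (\<Sum>l=1..L. \<integral>x. N l x powr q \<partial>\<mu>)"
proof -
  let ?\<nu> = "block_power d k \<mu>"
  note \<nu> = centered_gaussian_block_power[OF \<mu> \<open>1 \<le> k\<close>]
  have prob: "prob_space ?\<nu>" using \<nu> by (rule centered_gaussian_prob_space)
  have coord: "(\<lambda>\<omega>. \<omega> (h l)) \<in> measurable M ?\<nu>" if "l \<in> {1..L}" for l
    unfolding M_def using h[OF that] by (rule measurable_component_singleton)
  have bmax: "block_max d k (N l) \<in> borel_measurable ?\<nu>" if "l \<in> {1..L}" for l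
    using norm_on_R_measurable[OF norm_on_R_block_max[OF N[OF that] \<open>1 \<le> k\<close>]]
    by (simp cong: measurable_cong_sets add: centered_gaussian_sets[OF \<nu>])
  show W_meas: "W \<in> borel_measurable M"
    unfolding W_def
    by (intro borel_measurable_Max measurable_compose[OF coord bmax]) auto
  have bmax_nonneg: "0 \<le> block_max d k (N l) x" if "l \<in> {1..L}" for l x
    using le_block_max[of 0 k "N l" d x] norm_on_R_nonneg[OF N[OF that] block_in_R_space, of 0 x] \<open>1 \<le> k\<close>
    by simp
  have attained: "\<exists>l\<in>{1..L}. W \<omega> = block_max d k (N l) (\<omega> (h l))" for \<omega>
  proof -
    have "W \<omega> \<in> (\<lambda>l. block_max d k (N l) (\<omega> (h l))) ` {1..L}"
      unfolding W_def using \<open>1 \<le> L\<close> by (intro Max_in) auto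
    then show ?thesis by auto
  qed
  then show W_nonneg: "0 \<le> W \<omega>" for \<omega>
    using bmax_nonneg by metis
  have law: "distr M (borel_R d) (\<lambda>\<omega>. block d j (\<omega> (h l))) = \<mu>" 
    and comp: "(\<lambda>\<omega>. block d j (\<omega> (h l))) \<in> measurable M \<mu>" if "j < k" "l \<in> {1..L}" for j l
  proof -
    have blk: "block d j \<in> measurable ?\<nu> (borel_R d)"
      using block_measurable[OF \<open>j < k\<close>] by (simp cong: measurable_cong_sets add: centered_gaussian_sets[OF \<nu>])
    have "distr M (borel_R d) (\<lambda>\<omega>. block d j (\<omega> (h l))) = distr (distr M ?\<nu> (\<lambda>\<omega>. \<omega> (h l))) (borel_R d) (block d j)"
      by (subst distr_distr[OF blk coord[OF that(2)]]) (simp add: comp_def)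
    also have "distr M ?\<nu> (\<lambda>\<omega>. \<omega> (h l)) = ?\<nu>"
      unfolding M_def using h[OF that(2)] prob by (intro distr_PiM_component) auto
    also have "distr ?\<nu> (borel_R d) (block d j) = \<mu>"
      by (rule distr_block_power[OF \<mu> \<open>j < k\<close>])
    finally show "distr M (borel_R d) (\<lambda>\<omega>. block d j (\<omega> (h l))) = \<mu>" .
    show "(\<lambda>\<omega>. block d j (\<omega> (h l))) \<in> measurable M \<mu>"
      using measurable_compose[OF coord[OF that(2)] blk]
      by (simp cong: measurable_cong_sets add: centered_gaussian_sets[OF \<mu>])
  qed
  have law': "distr M \<mu> (\<lambda>\<omega>. block d j (\<omega> (h l))) = \<mu>" if "j < k" "l \<in> {1..L}" for j l
    using law[OF that] by (subst (asm) distr_cong[OF refl centered_gaussian_sets[OF \<mu>, symmetric] refl])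
  have N_meas: "(\<lambda>x. N l x powr q) \<in> borel_measurable \<mu>" if "l \<in> {1..L}" for l
    using norm_on_R_integrable_powr[OF \<mu> N[OF that] \<open>0 < q\<close>] by auto
  have int: "integrable M (\<lambda>\<omega>. N l (block d j (\<omega> (h l))) powr q)" if "j < k" "l \<in> {1..L}" for j l
    using norm_on_R_integrable_powr[OF \<mu> N[OF that(2)] \<open>0 < q\<close>] integrable_distr[OF comp[OF that], of "\<lambda>x. N l x powr q"]
    by (simp add: law'[OF that])
  have eq: "(\<integral>\<omega>. N l (block d j (\<omega> (h l))) powr q \<partial>M) = (\<integral>x. N l x powr q \<partial>\<mu>)" if "j < k" "l \<in> {1..L}" for j l
    using integral_distr[OF comp[OF that] N_meas[OF that(2)]] by (simp add: law'[OF that])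
  have dom: "integrable M (\<lambda>\<omega>. \<Sum>l=1..L. \<Sum>j<k. N l (block d j (\<omega> (h l))) powr q)"
    by (intro Bochner_Integration.integrable_sum int) auto
  have le: "W \<omega> powr q \<le> (\<Sum>l=1..L. \<Sum>j<k. N l (block d j (\<omega> (h l))) powr q)" for \<omega>
  proof -
    obtain l where l: "l \<in> {1..L}" "W \<omega> = block_max d k (N l) (\<omega> (h l))"
      using attained by blast
    obtain j where j: "j < k" "block_max d k (N l) (\<omega> (h l)) = N l (block d j (\<omega> (h l)))"
      by (rule block_max_attained[OF \<open>1 \<le> k\<close>])
    have "W \<omega> powr q \<le> (\<Sum>j<k. N l (block d j (\<omega> (h l))) powr q)"
      using j l by (auto intro!: member_le_sum[of j "{..<k}" "\<lambda>j. N l (block d j (\<omega> (h l))) powr q"])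
    also have "\<dots> \<le> (\<Sum>l=1..L. \<Sum>j<k. N l (block d j (\<omega> (h l))) powr q)"
      using l(1) by (intro member_le_sum[of l "{1..L}" "\<lambda>l. \<Sum>j<k. N l (block d j (\<omega> (h l))) powr q"]) (auto intro: sum_nonneg)
    finally show ?thesis .
  qed
  show "integrable M (\<lambda>\<omega>. W \<omega> powr q)"
    using W_meas le by (intro Bochner_Integration.integrable_bound[OF dom]) (auto intro!: AE_I2 order_trans[OF _ abs_ge_self])
  have "(\<integral>\<omega>. W \<omega> powr q \<partial>M) \<le> (\<integral>\<omega>. (\<Sum>l=1..L. \<Sum>j<k. N l (block d j (\<omega> (h l))) powr q) \<partial>M)"
    using le by (intro integral_mono'[OF dom]) (auto intro!: sum_nonneg)
  also have "\<dots> = (\<Sum>l=1..L. \<integral>\<omega>. (\<Sum>j<k. N l (block d j (\<omega> (h l))) powr q) \<partial>M)"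
    by (intro Bochner_Integration.integral_sum Bochner_Integration.integrable_sum int) auto
  also have "\<dots> = (\<Sum>l=1..L. \<Sum>j<k. \<integral>\<omega>. N l (block d j (\<omega> (h l))) powr q \<partial>M)"
    by (intro sum.cong refl Bochner_Integration.integral_sum int) auto
  also have "\<dots> = (\<Sum>l=1..L. real k * (\<integral>x. N l x powr q \<partial>\<mu>))"
    by (intro sum.cong refl) (simp add: eq)
  finally show "(\<integral>\<omega>. W \<omega> powr q \<partial>M) \<le> real k * (\<Sum>l=1..L. \<integral>x. N l x powr q \<partial>\<mu>)"
    by (simp add: sum_distrib_left)
qed

lemma norm_balls_sets:
  fixes t :: real
  assumes N: "\<And>l. l \<in> J \<Longrightarrow> norm_on_R d (N l)" and "finite J"
  shows "{x \<in> R_space d. \<forall>l\<in>J. N l x \<le> t} \<in> sets (borel_R d)"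
proof -
  have "{x \<in> space (borel_R d). \<forall>l\<in>J. N l x \<le> t} \<in> sets (borel_R d)"
    using \<open>finite J\<close> by (intro sets.sets_Collect_finite_All borel_measurable_le norm_on_R_measurable[OF N]) auto
  then show ?thesis
    unfolding space_borel_R .
qed

text \<open>The case \<open>J = {1..L}\<close> gives the event for the single Gaussian vector; singletons \<open>J\<close> give the
  factors of the event for independent vectors.\<close>

lemma measure_block_max_le:
  fixes t :: real
  assumes \<mu>: "centered_gaussian d \<mu>" and N: "\<And>l. l \<in> J \<Longrightarrow> norm_on_R d (N l)" and "finite J" "1 \<le> k"
  defines "S \<equiv> {x \<in> space (block_power d k \<mu>). \<forall>l\<in>J. block_max d k (N l) x \<le> t}"
  shows "S \<in> sets (block_power d k \<mu>)"
    and "measure (block_power d k \<mu>) S = measure \<mu> {x \<in> R_space d. \<forall>l\<in>J. N l x \<le> t} ^ k"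
proof -
  note K = norm_balls_sets[where N = N and t = t, OF N \<open>finite J\<close>]
  have S: "S = {x \<in> R_space (k * d). \<forall>j<k. block d j x \<in> {x \<in> R_space d. \<forall>l\<in>J. N l x \<le> t}}"
    unfolding S_def centered_gaussian_space[OF centered_gaussian_block_power[OF \<mu> \<open>1 \<le> k\<close>]]
    using block_in_R_space by (auto simp: block_max_le_iff[OF \<open>1 \<le> k\<close>])
  show "S \<in> sets (block_power d k \<mu>)"
    unfolding S centered_gaussian_sets[OF centered_gaussian_block_power[OF \<mu> \<open>1 \<le> k\<close>]]
    by (rule all_blocks_sets[OF K])
  show "measure (block_power d k \<mu>) S = measure \<mu> {x \<in> R_space d. \<forall>l\<in>J. N l x \<le> t} ^ k"
    unfolding S by (rule measure_block_power[OF \<mu> K])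
qed

text \<open>The hypothesis is applied to \<open>k\<close> independent copies of the Gaussian vector, glued into one vector in
  dimension \<open>k d\<close>, and to the norms \<open>max\<^sub>j N\<^sub>l(x\<^sub>j)\<close> of the blocks. Both probabilities to be compared
  are then raised to the power \<open>k\<close>, while the moments grow only linearly in \<open>k\<close>.\<close>

lemma min_comparison_imp_gaussian_comparison:
  fixes N :: "nat \<Rightarrow> (nat \<Rightarrow> real) \<Rightarrow> real"
  assumes cmp: "min_comparison q C" and "0 < q" "0 < C" "C < \<alpha>"
    and "1 \<le> d" "1 \<le> L" and \<mu>: "centered_gaussian d \<mu>"
    and N: "\<And>l. l \<in> {1..L} \<Longrightarrow> norm_on_R d (N l)"
  shows "(\<Prod>l=1..L. measure \<mu> {x \<in> R_space d. N l x \<le> 1})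
    \<le> measure \<mu> {x \<in> R_space d. \<forall>l\<in>{1..L}. N l x \<le> \<alpha>}"
proof -
  interpret \<mu>: prob_space \<mu> using \<mu> by (rule centered_gaussian_prob_space)
  define a where "a = measure \<mu> {x \<in> R_space d. \<forall>l\<in>{1..L}. N l x \<le> \<alpha>}"
  define b where "b = (\<Prod>l=1..L. measure \<mu> {x \<in> R_space d. N l x \<le> 1})"
  define B where "B = (\<Sum>l=1..L. \<integral>x. N l x powr q \<partial>\<mu>)"
  have ineq: "\<alpha> powr q * (1 - a ^ k) ^ n \<le> C powr q * (1 + (1 - b ^ k) ^ (n - 1) * (real k * B))"
    if "1 \<le> k" "1 \<le> n" for k n
  proof -
    define \<nu> where "\<nu> = block_power d k \<mu>"
    define M where "M = Pi\<^sub>M {0..L} (\<lambda>_. \<nu>)"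
    define Y where "Y = (\<lambda>\<omega>::sample. MAX l\<in>{1..L}. block_max d k (N l) (\<omega> 0))"
    define X where "X = (\<lambda>\<omega>::sample. MAX l\<in>{1..L}. block_max d k (N l) (\<omega> l))"
    have \<nu>: "centered_gaussian (k * d) \<nu>"
      unfolding \<nu>_def by (rule centered_gaussian_block_power[OF \<mu> \<open>1 \<le> k\<close>])
    interpret \<nu>: prob_space \<nu> using \<nu> by (rule centered_gaussian_prob_space)
    have M_prob: "prob_space M"
      unfolding M_def by (rule prob_space_PiM) (rule \<nu>.prob_space_axioms)
    note moment = block_max_moment[where N = N, OF \<mu> N \<open>1 \<le> k\<close> \<open>1 \<le> L\<close> \<open>0 < q\<close>]
    have Y: "Y \<in> borel_measurable M" "\<And>\<omega>. \<omega> \<in> space M \<Longrightarrow> 0 \<le> Y \<omega>" "integrable M (\<lambda>\<omega>. Y \<omega> powr q)"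
      unfolding Y_def M_def \<nu>_def by (rule moment(1-3)[where h = "\<lambda>_. 0"]; simp)+
    have X: "X \<in> borel_measurable M" "\<And>\<omega>. \<omega> \<in> space M \<Longrightarrow> 0 \<le> X \<omega>" "integrable M (\<lambda>\<omega>. X \<omega> powr q)"
      unfolding X_def M_def \<nu>_def by (rule moment(1-3)[where h = "\<lambda>l. l"]; auto)+
    have X_moment: "(\<integral>\<omega>. X \<omega> powr q \<partial>M) \<le> real k * B"
      unfolding X_def M_def \<nu>_def B_def by (rule moment(4)[where h = "\<lambda>l. l"]) auto
    have coord_space: "\<omega> l \<in> space \<nu>" if "\<omega> \<in> space M" "l \<le> L" for \<omega> l
      using that PiE_mem[of \<omega> "{0..L}" "\<lambda>_. space \<nu>" l] by (simp add: M_def space_PiM)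
    have Y_prob: "measure M {\<omega> \<in> space M. Y \<omega> \<le> \<alpha>} = a ^ k"
    proof -
      define S where "S = {x \<in> space \<nu>. \<forall>l\<in>{1..L}. block_max d k (N l) x \<le> \<alpha>}"
      have S: "S \<in> sets \<nu>" "measure \<nu> S = a ^ k"
        unfolding S_def \<nu>_def a_def by (intro measure_block_max_le \<mu> N \<open>1 \<le> k\<close>; simp)+
      have Y_le: "Y \<omega> \<le> \<alpha> \<longleftrightarrow> (\<forall>l\<in>{1..L}. block_max d k (N l) (\<omega> 0) \<le> \<alpha>)" for \<omega>
        unfolding Y_def using \<open>1 \<le> L\<close> by (subst Max_le_iff) auto
      have "{\<omega> \<in> space M. Y \<omega> \<le> \<alpha>} = {\<omega> \<in> space M. \<forall>i\<in>{0}. \<omega> i \<in> S}"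
        unfolding Y_le S_def using coord_space by auto
      also have "measure M \<dots> = (\<Prod>i\<in>{0::nat}. measure \<nu> S)"
        unfolding M_def using S(1) by (intro \<nu>.prob_PiM_coordinates) auto
      also have "\<dots> = a ^ k"
        using S(2) by simp
      finally show ?thesis .
    qed
    have X_prob: "measure M {\<omega> \<in> space M. X \<omega> \<le> 1} = b ^ k"
    proof -
      define S where "S l = {x \<in> space \<nu>. \<forall>l\<in>{l}. block_max d k (N l) x \<le> 1}" for l
      have S: "S l \<in> sets \<nu>" "measure \<nu> (S l) = measure \<mu> {x \<in> R_space d. N l x \<le> 1} ^ k"
        if "l \<in> {1..L}" for l
        unfolding S_def \<nu>_def using measure_block_max_le[OF \<mu> _ _ \<open>1 \<le> k\<close>, of "{l}" N] N[OF that] by auto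
      have X_le: "X \<omega> \<le> 1 \<longleftrightarrow> (\<forall>l\<in>{1..L}. block_max d k (N l) (\<omega> l) \<le> 1)" for \<omega>
        unfolding X_def using \<open>1 \<le> L\<close> by (subst Max_le_iff) auto
      have "{\<omega> \<in> space M. X \<omega> \<le> 1} = {\<omega> \<in> space M. \<forall>l\<in>{1..L}. \<omega> l \<in> S l}"
        unfolding X_le S_def using coord_space by auto
      also have "measure M \<dots> = (\<Prod>l=1..L. measure \<nu> (S l))"
        unfolding M_def using S(1) by (intro \<nu>.prob_PiM_coordinates) auto
      also have "\<dots> = (\<Prod>l=1..L. measure \<mu> {x \<in> R_space d. N l x \<le> 1} ^ k)"
        by (intro prod.cong refl S)
      finally show ?thesis
        unfolding b_def prod_power_distrib .
    qed
    have dim: "1 \<le> k * d" using \<open>1 \<le> k\<close> \<open>1 \<le> d\<close> by simp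
    have iid: "iid_centered_gaussian (k * d) M (\<lambda>l \<omega>. \<omega> l) {0..L}"
      unfolding M_def by (rule iid_centered_gaussian_coordinates[OF \<nu>]) simp
    have "min_norm M q n Y \<le> C * min_norm M q n X"
      unfolding X_def Y_def
      by (rule min_comparisonD[OF cmp dim \<open>1 \<le> L\<close> \<open>1 \<le> n\<close> norm_on_R_block_max[OF N \<open>1 \<le> k\<close>] iid])
    moreover have "0 \<le> min_norm M q n Y" "0 \<le> min_norm M q n X"
      unfolding min_norm_def Lq_norm_def by (rule powr_ge_zero)+
    ultimately have "min_norm M q n Y powr q \<le> C powr q * min_norm M q n X powr q"
      using powr_mono2[of q "min_norm M q n Y" "C * min_norm M q n X"] \<open>0 < q\<close> \<open>0 < C\<close> by (simp add: powr_mult)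
    moreover have "\<alpha> powr q * (1 - a ^ k) ^ n \<le> min_norm M q n Y powr q"
      unfolding Y_prob[symmetric]
      using \<open>0 < C\<close> \<open>C < \<alpha>\<close> by (intro prob_space.min_norm_lower_bound[OF M_prob \<open>0 < q\<close> _ \<open>1 \<le> n\<close> Y]) simp_all
    moreover have "min_norm M q n X powr q \<le> 1 + (1 - b ^ k) ^ (n - 1) * (real k * B)"
    proof -
      have "min_norm M q n X powr q \<le> 1 + (1 - b ^ k) ^ (n - 1) * (\<integral>\<omega>. X \<omega> powr q \<partial>M)"
        unfolding X_prob[symmetric]
        by (rule prob_space.min_norm_upper_bound[OF M_prob \<open>0 < q\<close> \<open>1 \<le> n\<close> X])
      also have "0 \<le> 1 - b ^ k"
        unfolding X_prob[symmetric] using prob_space.prob_le_1[OF M_prob] by simp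
      then have "1 + (1 - b ^ k) ^ (n - 1) * (\<integral>\<omega>. X \<omega> powr q \<partial>M) \<le> 1 + (1 - b ^ k) ^ (n - 1) * (real k * B)"
        using X_moment by (intro add_left_mono mult_left_mono zero_le_power)
      finally show ?thesis .
    qed
    then have "C powr q * min_norm M q n X powr q \<le> C powr q * (1 + (1 - b ^ k) ^ (n - 1) * (real k * B))"
      by (intro mult_left_mono powr_ge_zero)
    ultimately show ?thesis
      by linarith
  qed
  have "b \<le> a"
  proof (rule ccontr)
    assume "\<not> b \<le> a"
    then have "a < b" by simp
    moreover have "0 \<le> a" by (simp add: a_def)
    moreover have "b \<le> 1" unfolding b_def by (intro prod_le_1 conjI \<mu>.prob_le_1 measure_nonneg)
    moreover have "0 \<le> B" unfolding B_def by (intro sum_nonneg) simp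
    ultimately have "\<alpha> powr q \<le> C powr q"
      by (intro tensor_power_contradiction[OF _ _ _ _ _ _ ineq]) simp_all
    then show False
      using powr_less_mono2[of q C \<alpha>] assms(2-4) by simp
  qed
  then show ?thesis by (simp add: a_def b_def)
qed

section \<open>From norms to convex symmetric sets\<close>

text \<open>If some \<open>A\<^sub>i\<close> is null, the product vanishes. Otherwise almost every point lies in all the spans, and
  there \<open>N\<^sub>i \<le> C + 1\<close> puts it into the dilate of \<open>A\<^sub>i\<close> by every factor larger than \<open>C + 1\<close>. Two units are added to \<open>C\<close>: one because the comparison of norms needs \<open>\<alpha> > C\<close>, one because the
  closed ball of the Minkowski functional can be larger than \<open>A\<^sub>i\<close>.\<close>

lemma gaussian_intersection_bounded:
  fixes A :: "nat \<Rightarrow> (nat \<Rightarrow> real) set"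
  assumes cmp: "min_comparison q C" "0 < q" "0 < C"
    and "1 \<le> d" "1 \<le> l" and \<mu>: "centered_gaussian d \<mu>"
    and A: "\<And>i. i \<in> {1..l} \<Longrightarrow> A i \<in> sets (borel_R d)"
      "\<And>i. i \<in> {1..l} \<Longrightarrow> convex_R d (A i)" "\<And>i. i \<in> {1..l} \<Longrightarrow> symmetric_R d (A i)"
    and bounded: "\<And>i x j. i \<in> {1..l} \<Longrightarrow> x \<in> A i \<Longrightarrow> j < d \<Longrightarrow> \<bar>x j\<bar> \<le> R"
  shows "(\<Prod>i=1..l. measure \<mu> (A i)) \<le> measure \<mu> (dilate d (C + 2) (\<Inter>i\<in>{1..l}. A i))"
proof (cases "\<exists>i\<in>{1..l}. measure \<mu> (A i) = 0")
  case True
  then have zero: "(\<Prod>i=1..l. measure \<mu> (A i)) = 0" by auto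
  show ?thesis unfolding zero by simp
next
  case False
  interpret \<mu>: prob_space \<mu> using \<mu> by (rule centered_gaussian_prob_space)
  have pos: "0 < measure \<mu> (A i)" if "i \<in> {1..l}" for i
    using False that by (simp add: zero_less_measure_iff)
  have A_sub: "A i \<subseteq> R_space d" if "i \<in> {1..l}" for i
    using A(2)[OF that] by (simp add: convex_R_def)
  \<comment> \<open>the properties of the norm and of the equations that are chosen simultaneously for all \<open>i\<close>\<close>
  define adapted where "adapted i N U \<longleftrightarrow> norm_on_R d N \<and> (\<forall>x\<in>A i. N x \<le> 1)
      \<and> (\<forall>x\<in>A i. \<forall>j<d. (\<Sum>m<d. U j m * x m) = 0)
      \<and> (\<forall>x\<in>R_space d. \<forall>s. (\<forall>j<d. (\<Sum>m<d. U j m * x m) = 0) \<longrightarrow> N x < s \<longrightarrow> x \<in> dilate d s (A i))"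
    for i N and U :: "nat \<Rightarrow> nat \<Rightarrow> real"
  have "\<exists>N U. adapted i N U" if i: "i \<in> {1..l}" for i
  proof -
    interpret convex_symmetric_R d "A i"
      using A(2,3)[OF i] pos[OF i] by unfold_locales auto
    show ?thesis
      unfolding adapted_def
    proof (rule exists_norm)
      show "\<bar>x j\<bar> \<le> R" if "x \<in> A i" "j < d" for x j
        using bounded[OF i that] .
    qed blast
  qed
  then obtain N U where NU: "\<And>i. i \<in> {1..l} \<Longrightarrow> adapted i (N i) (U i)"
    by metis
  have N: "norm_on_R d (N i)" if "i \<in> {1..l}" for i
    using NU[OF that] unfolding adapted_def by blast
  have N_le: "N i x \<le> 1" if "i \<in> {1..l}" "x \<in> A i" for i x
    using NU[OF that(1)] that(2) unfolding adapted_def by blast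
  have U: "(\<Sum>m<d. U i j m * x m) = 0" if "i \<in> {1..l}" "x \<in> A i" "j < d" for i x j
    using NU[OF that(1)] that(2,3) unfolding adapted_def by blast
  have ball: "x \<in> dilate d s (A i)"
    if "i \<in> {1..l}" "x \<in> R_space d" "\<forall>j<d. (\<Sum>m<d. U i j m * x m) = 0" "N i x < s" for i x s
    using NU[OF that(1)] that(2-4) unfolding adapted_def by blast
  have N_ball: "{x \<in> R_space d. N i x \<le> 1} \<in> sets \<mu>" if "i \<in> {1..l}" for i
    using norm_on_R_measurable[OF N[OF that]] borel_measurable_le[of "N i" "borel_R d" "\<lambda>_. 1"]
    by (simp add: space_borel_R centered_gaussian_sets[OF \<mu>])
  have Int_sets: "(\<Inter>i\<in>{1..l}. A i) \<in> sets (borel_R d)"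
    using A(1) \<open>1 \<le> l\<close> by (intro sets.finite_INT) auto
  have "(\<Prod>i=1..l. measure \<mu> (A i)) \<le> (\<Prod>i=1..l. measure \<mu> {x \<in> R_space d. N i x \<le> 1})"
  proof (intro prod_mono conjI \<mu>.finite_measure_mono N_ball measure_nonneg)
    fix i assume i: "i \<in> {1..l}"
    show "A i \<subseteq> {x \<in> R_space d. N i x \<le> 1}"
      using N_le[OF i] A_sub[OF i] by blast
  qed
  also have "\<dots> \<le> measure \<mu> {x \<in> R_space d. \<forall>i\<in>{1..l}. N i x \<le> C + 1}"
    by (rule min_comparison_imp_gaussian_comparison[OF cmp _ \<open>1 \<le> d\<close> \<open>1 \<le> l\<close> \<mu> N]) simp
  also have "\<dots> \<le> measure \<mu> (dilate d (C + 2) (\<Inter>i\<in>{1..l}. A i))"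
  proof (rule \<mu>.finite_measure_mono_AE)
    show "dilate d (C + 2) (\<Inter>i\<in>{1..l}. A i) \<in> sets \<mu>"
      using dilate_in_sets[OF _ Int_sets] \<open>0 < C\<close> by (simp add: centered_gaussian_sets[OF \<mu>])
    have "AE x in \<mu>. \<forall>i\<in>{1..l}. \<forall>j\<in>{..<d}. (\<Sum>m<d. U i j m * x m) = 0"
      using centered_gaussian_zero_one[OF \<mu> A(1) pos U]
      by (intro AE_finite_allI) auto
    then show "AE x in \<mu>. x \<in> {x \<in> R_space d. \<forall>i\<in>{1..l}. N i x \<le> C + 1}
        \<longrightarrow> x \<in> dilate d (C + 2) (\<Inter>i\<in>{1..l}. A i)"
    proof eventually_elim
      case (elim x)
      show ?case
      proof
        assume x: "x \<in> {x \<in> R_space d. \<forall>i\<in>{1..l}. N i x \<le> C + 1}"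
        have "x \<in> dilate d (C + 2) (A i)" if "i \<in> {1..l}" for i
          using x elim that \<open>0 < C\<close> by (intro ball) force+
        then have "vscale d (1 / (C + 2)) x \<in> A i" if "i \<in> {1..l}" for i
          using mem_dilate_iff[OF _ A_sub[OF that], of "C + 2" x] \<open>0 < C\<close> that by simp
        moreover have "(\<Inter>i\<in>{1..l}. A i) \<subseteq> R_space d"
          using \<open>1 \<le> l\<close> by (intro INF_lower2[of 1] A_sub) simp_all
        ultimately show "x \<in> dilate d (C + 2) (\<Inter>i\<in>{1..l}. A i)"
          using x \<open>0 < C\<close> by (subst mem_dilate_iff) auto
      qed
    qed
  qed
  finally show ?thesis .
qed

definition cube :: "nat \<Rightarrow> real \<Rightarrow> (nat \<Rightarrow> real) set" where
  "cube d R = {x \<in> R_space d. \<forall>j<d. \<bar>x j\<bar> \<le> R}"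

lemma cube_sets: "cube d R \<in> sets (borel_R d)"
proof -
  have "{x \<in> space (borel_R d). \<forall>j\<in>{..<d}. \<bar>x j\<bar> \<le> R} \<in> sets (borel_R d)"
    by (intro sets.sets_Collect_finite_All borel_measurable_le borel_measurable_abs measurable_coord) auto
  then show ?thesis
    by (simp add: cube_def space_borel_R Ball_def)
qed

lemma convex_Int_cube:
  assumes "convex_R d A"
  shows "convex_R d (A \<inter> cube d R)"
  unfolding convex_R_def
proof (intro conjI ballI allI impI)
  show "A \<inter> cube d R \<subseteq> R_space d" by (auto simp: cube_def)
  fix x y u v assume x: "x \<in> A \<inter> cube d R" and y: "y \<in> A \<inter> cube d R"
    and uv: "0 \<le> u" "0 \<le> v" "u + v = (1::real)"
  have "\<bar>u * x j + v * y j\<bar> \<le> R" if "j < d" for j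
  proof -
    have "\<bar>u * x j + v * y j\<bar> \<le> u * \<bar>x j\<bar> + v * \<bar>y j\<bar>"
      using uv abs_triangle_ineq[of "u * x j" "v * y j"] by (simp add: abs_mult)
    also have "\<dots> \<le> R"
      using uv x y that by (intro convex_bound_le) (auto simp: cube_def)
    finally show ?thesis .
  qed
  then have "vadd d (vscale d u x) (vscale d v y) \<in> cube d R"
    by (auto simp: cube_def vadd_def vscale_def)
  moreover have "vadd d (vscale d u x) (vscale d v y) \<in> A"
    using assms x y uv by (auto simp: convex_R_def)
  ultimately show "vadd d (vscale d u x) (vscale d v y) \<in> A \<inter> cube d R" by simp
qed

lemma symmetric_Int_cube:
  assumes "symmetric_R d A"
  shows "symmetric_R d (A \<inter> cube d R)"
proof -
  have sub: "A \<inter> cube d R \<subseteq> R_space d" and A: "A \<subseteq> R_space d"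
    using assms by (auto simp: symmetric_R_def)
  have flip: "vscale d (- 1) x \<in> A \<inter> cube d R" if "x \<in> A \<inter> cube d R" for x
    using that symmetric_R_minus[OF assms, of x] by (auto simp: cube_def vscale_def)
  have "x \<in> A \<inter> cube d R \<longleftrightarrow> x \<in> dilate d (- 1) (A \<inter> cube d R)" for x
  proof
    assume "x \<in> A \<inter> cube d R"
    with flip[OF this] sub show "x \<in> dilate d (- 1) (A \<inter> cube d R)"
      by (subst mem_dilate_iff) auto
  next
    assume "x \<in> dilate d (- 1) (A \<inter> cube d R)"
    then have "x \<in> R_space d" "vscale d (- 1) x \<in> A \<inter> cube d R"
      using sub by (auto simp: mem_dilate_iff)
    with flip[of "vscale d (- 1) x"] show "x \<in> A \<inter> cube d R"
      by (simp add: vscale_vscale vscale_one)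
  qed
  then show ?thesis
    using sub unfolding symmetric_R_def by blast
qed

lemma measure_Int_cube_LIMSEQ:
  assumes \<mu>: "centered_gaussian d \<mu>" and A: "A \<in> sets (borel_R d)"
  shows "(\<lambda>n. measure \<mu> (A \<inter> cube d (real n))) \<longlonglongrightarrow> measure \<mu> A"
proof -
  interpret \<mu>: prob_space \<mu> using \<mu> by (rule centered_gaussian_prob_space)
  have "(\<lambda>n. measure \<mu> (A \<inter> cube d (real n))) \<longlonglongrightarrow> measure \<mu> (\<Union>n. A \<inter> cube d (real n))"
  proof (rule \<mu>.finite_Lim_measure_incseq)
    show "range (\<lambda>n. A \<inter> cube d (real n)) \<subseteq> sets \<mu>"
      using A cube_sets by (auto simp: centered_gaussian_sets[OF \<mu>])
    show "incseq (\<lambda>n. A \<inter> cube d (real n))"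
      by (fastforce simp: incseq_def cube_def)
  qed
  moreover have "(\<Union>n. A \<inter> cube d (real n)) = A"
  proof -
    have "\<exists>n. x \<in> cube d (real n)" if "x \<in> A" for x
    proof -
      obtain n where n: "(\<Sum>j<d. \<bar>x j\<bar>) \<le> real n" using real_arch_simple by blast
      have "\<bar>x j\<bar> \<le> real n" if "j < d" for j
        using n member_le_sum[of j "{..<d}" "\<lambda>j. \<bar>x j\<bar>"] that by auto
      moreover have "x \<in> R_space d"
        using sets.sets_into_space[OF A] \<open>x \<in> A\<close> by (auto simp: space_borel_R)
      ultimately show ?thesis by (auto simp: cube_def)
    qed
    then show ?thesis by auto
  qed
  ultimately show ?thesis by simp
qed

theorem corollary6p9:
  assumes "\<exists>q>0. \<exists>C>0. \<forall>d\<ge>1. \<forall>L\<ge>1. \<forall>N :: nat \<Rightarrow> (nat \<Rightarrow> real) \<Rightarrow> real.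
    \<forall>M :: sample measure. \<forall>G :: nat \<Rightarrow> sample \<Rightarrow> nat \<Rightarrow> real.
      (\<forall>l\<in>{1..L}. norm_on_R d (N l)) \<longrightarrow> iid_centered_gaussian d M G {0..L} \<longrightarrow>
      (\<forall>n\<ge>1. min_norm M q n (\<lambda>\<omega>. MAX l\<in>{1..L}. N l (G 0 \<omega>))
           \<le> C * min_norm M q n (\<lambda>\<omega>. MAX l\<in>{1..L}. N l (G l \<omega>)))"
  shows "\<exists>\<alpha>>0. \<forall>d\<ge>1. \<forall>\<mu>. centered_gaussian d \<mu> \<longrightarrow>
    (\<forall>l\<ge>1. \<forall>A :: nat \<Rightarrow> (nat \<Rightarrow> real) set.
      (\<forall>i\<in>{1..l}. A i \<in> sets (borel_R d) \<and> convex_R d (A i) \<and> symmetric_R d (A i)) \<longrightarrow>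
      measure \<mu> (dilate d \<alpha> (\<Inter>i\<in>{1..l}. A i)) \<ge> (\<Prod>i=1..l. measure \<mu> (A i)))"
proof -
  obtain q C where qC: "0 < q" "0 < C" "min_comparison q C"
    using assms unfolding min_comparison_def by blast
  show ?thesis
  proof (intro exI[of _ "C + 2"] conjI allI impI)
    show "0 < C + 2" using qC by simp
  next
    fix d l :: nat and \<mu> and A :: "nat \<Rightarrow> (nat \<Rightarrow> real) set"
    assume "1 \<le> d" "1 \<le> l" and \<mu>: "centered_gaussian d \<mu>"
      and "\<forall>i\<in>{1..l}. A i \<in> sets (borel_R d) \<and> convex_R d (A i) \<and> symmetric_R d (A i)"
    then have A: "\<And>i. i \<in> {1..l} \<Longrightarrow> A i \<in> sets (borel_R d)"
      "\<And>i. i \<in> {1..l} \<Longrightarrow> convex_R d (A i)" "\<And>i. i \<in> {1..l} \<Longrightarrow> symmetric_R d (A i)"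
      by auto
    interpret \<mu>: prob_space \<mu> using \<mu> by (rule centered_gaussian_prob_space)
    let ?D = "dilate d (C + 2) (\<Inter>i\<in>{1..l}. A i)"
    have D: "?D \<in> sets \<mu>"
    proof -
      have "(\<Inter>i\<in>{1..l}. A i) \<in> sets (borel_R d)"
        using A(1) \<open>1 \<le> l\<close> by (intro sets.finite_INT) auto
      then show ?thesis
        using dilate_in_sets[of "C + 2"] qC by (simp add: centered_gaussian_sets[OF \<mu>])
    qed
    have "(\<Prod>i=1..l. measure \<mu> (A i \<inter> cube d (real n))) \<le> measure \<mu> ?D" for n
    proof -
      have "(\<Prod>i=1..l. measure \<mu> (A i \<inter> cube d (real n)))
          \<le> measure \<mu> (dilate d (C + 2) (\<Inter>i\<in>{1..l}. A i \<inter> cube d (real n)))"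
        using A cube_sets
        by (intro gaussian_intersection_bounded[OF qC(3,1,2) \<open>1 \<le> d\<close> \<open>1 \<le> l\<close> \<mu>, where R = "real n"]
            convex_Int_cube symmetric_Int_cube) (auto simp: cube_def)
      also have "\<dots> \<le> measure \<mu> ?D"
        by (intro \<mu>.finite_measure_mono D) (auto simp: dilate_def)
      finally show ?thesis .
    qed
    moreover have "(\<lambda>n. \<Prod>i=1..l. measure \<mu> (A i \<inter> cube d (real n))) \<longlonglongrightarrow> (\<Prod>i=1..l. measure \<mu> (A i))"
      by (intro tendsto_prod measure_Int_cube_LIMSEQ[OF \<mu>] A(1))
    ultimately show "(\<Prod>i=1..l. measure \<mu> (A i)) \<le> measure \<mu> ?D"
      by (intro LIMSEQ_le_const2) auto
  qed
qed

end
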